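(* Let $P$ be an $\mathcal{E}_s$ process and let $S$ be a set of containment structures with $\mathrm{CStrs}(P)\subseteq S$. Then for every $P'$: $P\to_s P'$ if and only if $[\![P]\!]^S\to_d[\![P']\!]^S$.
   Context: Fix a countably infinite set $\mathcal N$ of names. Prefixes are $\pi ::= a \mid \overline{a} \mid \widetilde{a}\{U\}$. Processes: $P ::= a[P] \mid P\parallel P \mid \sum_{i\in I}\pi_i.P_i \mid\ !\pi.P$ ($I$ finite); update patterns are terms of this grammar with a hole $\bullet$; $U\{Q\}$ replaces every hole of $U$ not inside an update prefix by $Q$ (commuting with $a[\cdot]$, $\parallel$, sums and replication). $\mathcal E_s$ processes: $P::=a[P]\mid P\parallel P\mid A$, $A ::= A\parallel A\mid\ !\pi.A\mid \sum_{i\in I}\pi_i.A_i$, $\pi::= a\mid\overline a\mid \widetilde a\{a[U]\parallel A\}$, $U$ a pattern over this grammar (holes allowed in both categories). Auxiliary: $\mathrm{numap}(\bullet)=0$, $\mathrm{numap}(a[U])=1+\mathrm{numap}(U)$, additive on $\parallel$, $0$ on sums/replications; $\mathrm{numholes}$: $1$ on $\bullet$, transparent through $a[\cdot]$, additive on $\parallel$, $\mathrm{numholes}(\sum_i\pi_i.U_i)=\sum_i\mathrm{numholes}(U_i)$, $\mathrm{numholes}(!\pi.U)=\mathrm{numholes}(U)$; $\mathrm{numph}$: $0$ on $\bullet$, transparent through $a[\cdot]$, additive on $\parallel$, $\mathrm{numph}(\sum_i\pi_i.U_i)=\sum_i\mathrm{numholes}(U_i)$, $\mathrm{numph}(!\pi.U)=\mathrm{numholes}(U)$.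 Writing a process up to commutativity/associativity of $\parallel$ as $\prod_i P_i\parallel\prod_j a_j[P'_j]$ ($P_i$ neither parallel nor located), its containment structure $\mathrm{CStr}$ is the unordered tree with root $\epsilon$ whose children are the roots of $\mathrm{CStr}(P'_j)$ relabelled $a_j$. $\mathrm{CStrs}(P)=\{\mathrm{CStr}(a[P''])\mid a[P''] \text{ a subterm of } P\}$ (trees whose root has exactly one child: "single-child"). Semantics. $a[P]\xrightarrow{a[P]}\star$ ($\star$ placeholder); $\sum_{i\in I}\pi_i.P_i\xrightarrow{\pi_j}P_j$; $!\pi.P\xrightarrow{\pi}P\parallel!\pi.P$; labels propagate through $a[\cdot]$ and either side of $\parallel$; $a$ and $\overline a$ in parallel components synchronise to $\tau$; if $P_1\xrightarrow{a[Q]}P_1'$, $P_2\xrightarrow{\widetilde a\{U\}}P_2'$ and $\mathsf{cond}(U,Q)$ then $P_1\parallel P_2\xrightarrow\tau P_1'[U\{Q\}/\star]\parallel P_2'$ (and symmetrically). $\to_d$: $\mathsf{cond}$ always true. $\to_s$: $\mathsf{cond}(U,Q)$ iff $U=a[U']\parallel A$, $\mathrm{CStr}(a[Q])=\mathrm{CStr}(a[U'\{Q\}]\parallel A)$ and ($\mathrm{numph}(U)>0\Rightarrow\mathrm{numap}(Q)=0$). $\to_s$ and $\to_d$ denote the $\tau$-transitions. Encoding. For a set $S$ of containment structures, $S\!\downarrow\! a$ is the set of single-child trees in $S$ whose root's only child is labelled $a$. Fix an injective map $\varphi$ from containment structures to names such that $\varphi(\mathrm{CStr}(a[P]))=\kappa_a$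 whenever $\mathrm{numap}(P)=0$; write $\varphi(a[P])$ for $\varphi(\mathrm{CStr}(a[P]))$. Let $\mathrm{err}\notin\varphi(S)$ be a name. $[\![\cdot]\!]=[\![\cdot]\!]^S$ is defined inductively on $\mathcal E_s$ processes and patterns, writing $\xi\pi.U$ for either $\pi.U$ or $!\pi.U$ (same $\xi$ on both sides): $[\![a[P]]\!]=\kappa[[\![P]\!]]$ with $\kappa=\varphi(a[P])$; $[\![\xi\,\widetilde a\{a[U]\parallel A\}.U_1]\!]=\xi\,\widetilde\kappa\{\kappa[[\![U]\!]]\parallel[\![A]\!]\}.[\![U_1]\!]$ with $\kappa=\varphi(a[U])$ if C1; $=\xi\,\widetilde{\kappa_a}\{\kappa_a[[\![U]\!]]\parallel[\![A]\!]\}.[\![U_1]\!]$ if C2; $[\![\widetilde a\{a[U]\parallel A\}.U_1]\!]=\sum_{\kappa_i\in\varphi(S\downarrow a)}\widetilde{\kappa_i}\{\kappa_i[[\![U]\!]]\parallel[\![A]\!]\}.[\![U_1]\!]$ and $[\![!\widetilde a\{a[U]\parallel A\}.U_1]\!]=\prod_{\kappa_i\in\varphi(S\downarrow a)}!\widetilde{\kappa_i}\{\kappa_i[[\![U]\!]]\parallel[\![A]\!]\}.[\![U_1]\!]$ if C3; $[\![\xi\,\widetilde a\{a[U]\parallel A\}.U_1]\!]=\xi\,\widetilde{\mathrm{err}}\{\mathbf 0\}.[\![U_1]\!]$ if C4; $[\![\xi\pi.U]\!]=\xi\pi.[\![U]\!]$ for $\pi\in\{a,\overline a\}$; $[\![\sum_i\pi_i.U_i]\!]=\sum_i[\![\pi_i.U_i]\!]$;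 $[\![U_1\parallel U_2]\!]=[\![U_1]\!]\parallel[\![U_2]\!]$; $[\![\bullet]\!]=\bullet$. Here C1: $\mathrm{numholes}(U)=0$; C2: $(\mathrm{numholes}(U)=1\wedge\mathrm{numph}(U)>0\wedge\mathrm{numap}(U)=0)\vee(\mathrm{numholes}(U)>1\wedge\mathrm{numap}(U)=0)$; C3: $\mathrm{numholes}(U)=1\wedge\mathrm{numph}(U)=0\wedge\mathrm{numap}(U)=0$; C4: $\mathrm{numholes}(U)\neq0\wedge\mathrm{numap}(U)\neq0$.
   Formalization: Right to left is false as stated: C4, and C3 with S↓a empty, erase prefixes. Shown for all P, P': that direction only up to P'' with the same encoding; the full equivalence when P, P' contain no such prefix. Reductions are up to AC of ∥, and each S↓a is assumed finite. *)

theory Defs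
  imports "HOL-Library.Multiset" "HOL-Library.Countable" "HOL-Library.Infinite_Typeclass"
begin

section \<open>Syntax\<close>

text \<open>
  Processes and update patterns share one type of terms.  \<open>Hole\<close> is the hole of update patterns,
  \<open>Star\<close> is the placeholder of the labelled semantics.  A finite sum, i.e. a finite family of
  prefixed terms up to renaming of the index set, is a finite multiset of summands.
\<close>

datatype 'n trm =
    Hole
  | Star
  | Loc 'n "'n trm"
  | Par "'n trm" "'n trm"
  | Sum "('n prefix \<times> 'n trm) multiset"
  | Rep "'n prefix" "'n trm"
and 'n prefix =
    In 'n
  | Out 'n
  | Upd 'n "'n trm"

abbreviation Nil_proc :: "'n trm" where
  "Nil_proc \<equiv> Sum {#}"

lemma size_summand [termination_simp]:
  assumes "(p, U) \<in># M"
  shows "size p < Suc (size_multiset (\<lambda>x. Suc (size (fst x) + size (snd x))) M)"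
    and "size U < Suc (size_multiset (\<lambda>x. Suc (size (fst x) + size (snd x))) M)"
proof -
  obtain N where "M = add_mset (p, U) N"
    using assms by (metis mset_add)
  then show "size p < Suc (size_multiset (\<lambda>x. Suc (size (fst x) + size (snd x))) M)"
    and "size U < Suc (size_multiset (\<lambda>x. Suc (size (fst x) + size (snd x))) M)"
    by simp_all
qed

text \<open>Filling of holes does not enter update prefixes; prefixes are therefore left unchanged.\<close>

fun fill :: "'n trm \<Rightarrow> 'n trm \<Rightarrow> 'n trm" where
  "fill Hole Q = Q"
| "fill Star Q = Star"
| "fill (Loc a U) Q = Loc a (fill U Q)"
| "fill (Par U V) Q = Par (fill U Q) (fill V Q)"
| "fill (Sum M) Q = Sum (image_mset (\<lambda>(p, U). (p, fill U Q)) M)"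
| "fill (Rep p U) Q = Rep p (fill U Q)"

fun subst_star :: "'n trm \<Rightarrow> 'n trm \<Rightarrow> 'n trm" where
  "subst_star R Hole = Hole"
| "subst_star R Star = R"
| "subst_star R (Loc a P) = Loc a (subst_star R P)"
| "subst_star R (Par P Q) = Par (subst_star R P) (subst_star R Q)"
| "subst_star R (Sum M) = Sum (image_mset (\<lambda>(p, P). (p, subst_star R P)) M)"
| "subst_star R (Rep p P) = Rep p (subst_star R P)"

text \<open>
  The grammar of \<open>\<E>\<^sub>s\<close>.  The Boolean says whether holes are allowed outside update prefixes, so
  \<open>es_P False\<close> are the processes and \<open>es_P True\<close> the patterns.  In \<open>Upd a (Par (Loc a U) A)\<close> only
  \<open>U\<close> is a pattern, while \<open>A\<close> is a process of the second category.
\<close>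

inductive es_P :: "bool \<Rightarrow> 'n trm \<Rightarrow> bool"
  and es_A :: "bool \<Rightarrow> 'n trm \<Rightarrow> bool"
  and es_pre :: "'n prefix \<Rightarrow> bool"
where
  P_Loc: "es_P h P \<Longrightarrow> es_P h (Loc a P)"
| P_Par: "es_P h P \<Longrightarrow> es_P h Q \<Longrightarrow> es_P h (Par P Q)"
| P_A: "es_A h A \<Longrightarrow> es_P h A"
| A_Hole: "es_A True Hole"
| A_Par: "es_A h A \<Longrightarrow> es_A h B \<Longrightarrow> es_A h (Par A B)"
| A_Rep: "es_pre p \<Longrightarrow> es_A h A \<Longrightarrow> es_A h (Rep p A)"
| A_Sum: "(\<And>p A. (p, A) \<in># M \<Longrightarrow> es_pre p \<and> es_A h A) \<Longrightarrow> es_A h (Sum M)"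
| pre_In: "es_pre (In a)"
| pre_Out: "es_pre (Out a)"
| pre_Upd: "es_P True U \<Longrightarrow> es_A False A \<Longrightarrow> es_pre (Upd a (Par (Loc a U) A))"

abbreviation es_process :: "'n trm \<Rightarrow> bool" where
  "es_process \<equiv> es_P False"

text \<open>
  Commutativity and associativity of parallel composition, closed under the process constructors.
\<close>

inductive scong :: "'n trm \<Rightarrow> 'n trm \<Rightarrow> bool"  (infix "\<equiv>\<^sub>p" 50) where
  cong_refl: "P \<equiv>\<^sub>p P"
| cong_sym: "P \<equiv>\<^sub>p Q \<Longrightarrow> Q \<equiv>\<^sub>p P"
| cong_trans: "P \<equiv>\<^sub>p Q \<Longrightarrow> Q \<equiv>\<^sub>p R \<Longrightarrow> P \<equiv>\<^sub>p R"
| cong_comm: "Par P Q \<equiv>\<^sub>p Par Q P"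
| cong_assoc: "Par P (Par Q R) \<equiv>\<^sub>p Par (Par P Q) R"
| cong_Loc: "P \<equiv>\<^sub>p P' \<Longrightarrow> Loc a P \<equiv>\<^sub>p Loc a P'"
| cong_Par: "P \<equiv>\<^sub>p P' \<Longrightarrow> Q \<equiv>\<^sub>p Q' \<Longrightarrow> Par P Q \<equiv>\<^sub>p Par P' Q'"
| cong_Sum: "P \<equiv>\<^sub>p P' \<Longrightarrow> Sum (add_mset (p, P) M) \<equiv>\<^sub>p Sum (add_mset (p, P') M)"
| cong_Rep: "P \<equiv>\<^sub>p P' \<Longrightarrow> Rep p P \<equiv>\<^sub>p Rep p P'"


section \<open>Auxiliary functions and containment structures\<close>

fun numap :: "'n trm \<Rightarrow> nat" where
  "numap (Loc a U) = 1 + numap U"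
| "numap (Par U V) = numap U + numap V"
| "numap _ = 0"

fun numholes :: "'n trm \<Rightarrow> nat" where
  "numholes Hole = 1"
| "numholes Star = 0"
| "numholes (Loc a U) = numholes U"
| "numholes (Par U V) = numholes U + numholes V"
| "numholes (Sum M) = (\<Sum>(p, U)\<in>#M. numholes U)"
| "numholes (Rep p U) = numholes U"

fun numph :: "'n trm \<Rightarrow> nat" where
  "numph Hole = 0"
| "numph Star = 0"
| "numph (Loc a U) = numph U"
| "numph (Par U V) = numph U + numph V"
| "numph (Sum M) = (\<Sum>(p, U)\<in>#M. numholes U)"
| "numph (Rep p U) = numholes U"

text \<open>
  Finite unordered trees with root \<open>\<epsilon>\<close>.  A pair \<open>(a, T)\<close> stands for the child obtained from \<open>T\<close> by
  relabelling its root to \<open>a\<close>.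
\<close>

datatype 'n cstr = CNode "('n \<times> 'n cstr) multiset"

fun children :: "'n trm \<Rightarrow> ('n \<times> 'n cstr) multiset" where
  "children (Loc a P) = {#(a, CNode (children P))#}"
| "children (Par P Q) = children P + children Q"
| "children _ = {#}"

definition CStr :: "'n trm \<Rightarrow> 'n cstr" where
  "CStr P = CNode (children P)"

text \<open>
  Prefixes, and hence the patterns of update prefixes, do not contribute subterms.  Descending into
  them as well would yield a larger set.
\<close>

fun CStrs :: "'n trm \<Rightarrow> 'n cstr set" where
  "CStrs Hole = {}"
| "CStrs Star = {}"
| "CStrs (Loc a P) = insert (CStr (Loc a P)) (CStrs P)"
| "CStrs (Par P Q) = CStrs P \<union> CStrs Q"
| "CStrs (Sum M) = (\<Union>(p, P)\<in>set_mset M. CStrs P)"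
| "CStrs (Rep p P) = CStrs P"

definition child_restr :: "'n cstr set \<Rightarrow> 'n \<Rightarrow> 'n cstr set"  (infix "\<down>" 80) where
  "S \<down> a = {T \<in> S. \<exists>T'. T = CNode {#(a, T')#}}"


section \<open>Semantics\<close>

datatype 'n label = Pre "'n prefix" | Located 'n "'n trm" | Tau

inductive step :: "('n trm \<Rightarrow> 'n trm \<Rightarrow> bool) \<Rightarrow> 'n trm \<Rightarrow> 'n label \<Rightarrow> 'n trm \<Rightarrow> bool"
  for cond :: "'n trm \<Rightarrow> 'n trm \<Rightarrow> bool"
where
  s_Comp: "step cond (Loc a P) (Located a P) Star"
| s_Sum: "(p, P) \<in># M \<Longrightarrow> step cond (Sum M) (Pre p) P"
| s_Rep: "step cond (Rep p P) (Pre p) (Par P (Rep p P))"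
| s_Loc: "step cond P l P' \<Longrightarrow> step cond (Loc a P) l (Loc a P')"
| s_ParL: "step cond P l P' \<Longrightarrow> step cond (Par P Q) l (Par P' Q)"
| s_ParR: "step cond Q l Q' \<Longrightarrow> step cond (Par P Q) l (Par P Q')"
| s_SynL: "step cond P (Pre (In a)) P' \<Longrightarrow> step cond Q (Pre (Out a)) Q' \<Longrightarrow>
    step cond (Par P Q) Tau (Par P' Q')"
| s_SynR: "step cond P (Pre (Out a)) P' \<Longrightarrow> step cond Q (Pre (In a)) Q' \<Longrightarrow>
    step cond (Par P Q) Tau (Par P' Q')"
| s_UpdL: "step cond P (Located a R) P' \<Longrightarrow> step cond Q (Pre (Upd a U)) Q' \<Longrightarrow> cond U R \<Longrightarrow>
    step cond (Par P Q) Tau (Par (subst_star (fill U R) P') Q')"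
| s_UpdR: "step cond P (Pre (Upd a U)) P' \<Longrightarrow> step cond Q (Located a R) Q' \<Longrightarrow> cond U R \<Longrightarrow>
    step cond (Par P Q) Tau (Par P' (subst_star (fill U R) Q'))"

definition cond_s :: "'n trm \<Rightarrow> 'n trm \<Rightarrow> bool" where
  "cond_s U Q \<longleftrightarrow> (\<exists>a U' A. U = Par (Loc a U') A \<and>
     CStr (Loc a Q) = CStr (Par (Loc a (fill U' Q)) A) \<and>
     (numph U > 0 \<longrightarrow> numap Q = 0))"

definition cond_d :: "'n trm \<Rightarrow> 'n trm \<Rightarrow> bool" where
  "cond_d U Q \<longleftrightarrow> True"

text \<open>
  Reductions are taken up to \<open>\<equiv>\<^sub>p\<close>.  This is indispensable for the encoding below: unfolding one
  component of the product that encodes a replicated update produces the same parallel components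
  as the encoding of the unfolded replication, but in a different arrangement.
\<close>

definition red_s :: "'n trm \<Rightarrow> 'n trm \<Rightarrow> bool"  (infix "\<rightarrow>\<^sub>s" 50) where
  "P \<rightarrow>\<^sub>s P' \<longleftrightarrow> (\<exists>P''. step cond_s P Tau P'' \<and> P'' \<equiv>\<^sub>p P')"

definition red_d :: "'n trm \<Rightarrow> 'n trm \<Rightarrow> bool"  (infix "\<rightarrow>\<^sub>d" 50) where
  "P \<rightarrow>\<^sub>d P' \<longleftrightarrow> (\<exists>P''. step cond_d P Tau P'' \<and> P'' \<equiv>\<^sub>p P')"


section \<open>The encoding\<close>

definition C1 :: "'n trm \<Rightarrow> bool" where
  "C1 U \<longleftrightarrow> numholes U = 0"

definition C2 :: "'n trm \<Rightarrow> bool" where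
  "C2 U \<longleftrightarrow> (numholes U = 1 \<and> numph U > 0 \<and> numap U = 0) \<or> (numholes U > 1 \<and> numap U = 0)"

definition C3 :: "'n trm \<Rightarrow> bool" where
  "C3 U \<longleftrightarrow> numholes U = 1 \<and> numph U = 0 \<and> numap U = 0"

definition C4 :: "'n trm \<Rightarrow> bool" where
  "C4 U \<longleftrightarrow> numholes U \<noteq> 0 \<and> numap U \<noteq> 0"

lemma C_exhaustive: "C1 U \<or> C2 U \<or> C3 U \<or> C4 U"
  unfolding C1_def C2_def C3_def C4_def by linarith

lemma C_exclusive:
  "\<not> (C1 U \<and> C2 U)" "\<not> (C1 U \<and> C3 U)" "\<not> (C1 U \<and> C4 U)"
  "\<not> (C2 U \<and> C3 U)" "\<not> (C2 U \<and> C4 U)" "\<not> (C3 U \<and> C4 U)"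
  unfolding C1_def C2_def C3_def C4_def by auto

text \<open>An arbitrary enumeration of a finite set; up to \<open>\<equiv>\<^sub>p\<close> the encoding does not depend on it.\<close>

definition enum_set :: "'b set \<Rightarrow> 'b list" where
  "enum_set X = (SOME xs. distinct xs \<and> set xs = X)"

fun par_list :: "'n trm list \<Rightarrow> 'n trm" where
  "par_list [] = Nil_proc"
| "par_list [P] = P"
| "par_list (P # Q # Ps) = Par P (par_list (Q # Ps))"

text \<open>
  \<open>enc_pre\<close> maps a prefix to the list of prefixes that encode it: one for each member of
  \<open>\<phi>(S \<down> a)\<close> in case \<open>C3\<close>, exactly one in all other cases.  They become the alternatives of a sum
  or, under replication, the components of a product.  Update prefixes which are not of the form
  required by the grammar of \<open>\<E>\<^sub>s\<close> get an irrelevant value.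
\<close>

fun enc :: "'n cstr set \<Rightarrow> ('n cstr \<Rightarrow> 'n) \<Rightarrow> ('n \<Rightarrow> 'n) \<Rightarrow> 'n \<Rightarrow> 'n trm \<Rightarrow> 'n trm"
  and enc_pre :: "'n cstr set \<Rightarrow> ('n cstr \<Rightarrow> 'n) \<Rightarrow> ('n \<Rightarrow> 'n) \<Rightarrow> 'n \<Rightarrow> 'n prefix \<Rightarrow> 'n prefix list"
where
  "enc S \<phi> \<kappa> err Hole = Hole"
| "enc S \<phi> \<kappa> err Star = Star"
| "enc S \<phi> \<kappa> err (Loc a P) = Loc (\<phi> (CStr (Loc a P))) (enc S \<phi> \<kappa> err P)"
| "enc S \<phi> \<kappa> err (Par P Q) = Par (enc S \<phi> \<kappa> err P) (enc S \<phi> \<kappa> err Q)"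
| "enc S \<phi> \<kappa> err (Sum M) =
     Sum (\<Sum>(p, U)\<in>#M. mset (map (\<lambda>q. (q, enc S \<phi> \<kappa> err U)) (enc_pre S \<phi> \<kappa> err p)))"
| "enc S \<phi> \<kappa> err (Rep p U) =
     par_list (map (\<lambda>q. Rep q (enc S \<phi> \<kappa> err U)) (enc_pre S \<phi> \<kappa> err p))"
| "enc_pre S \<phi> \<kappa> err (In a) = [In a]"
| "enc_pre S \<phi> \<kappa> err (Out a) = [Out a]"
| "enc_pre S \<phi> \<kappa> err (Upd a (Par (Loc b U) A)) =
     (let upd = (\<lambda>k. Upd k (Par (Loc k (enc S \<phi> \<kappa> err U)) (enc S \<phi> \<kappa> err A))) in
      if C1 U then [upd (\<phi> (CStr (Loc a U)))]
      else if C2 U then [upd (\<kappa> a)]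
      else if C3 U then map upd (enum_set (\<phi> ` (S \<down> a)))
      else [Upd err Nil_proc])"
| "enc_pre S \<phi> \<kappa> err (Upd a U) = [Upd a U]"

text \<open>
  The encoding is not injective, not even up to \<open>\<equiv>\<^sub>p\<close>: the clause for \<open>C4\<close> forgets the name and the
  pattern of the update prefix, and so does the one for \<open>C3\<close> if \<open>S \<down> a\<close> is empty.  If
  \<open>CStrs P \<subseteq> S\<close> and \<open>err \<notin> \<phi>(S)\<close>, such prefixes never take part in an update step of \<open>P\<close> or of its
  encoding; but a process that contains them cannot be recovered from its encoding.
\<close>

lemma enc_C4_forgets:
  "enc S \<phi> \<kappa> err (Rep (Upd a (Par (Loc a (Loc b Hole)) A)) P) =
   enc S \<phi> \<kappa> err (Rep (Upd a (Par (Loc a (Loc c Hole)) A)) P)"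
  by (simp add: C1_def C2_def C3_def)

text \<open>\<open>no_inert S P\<close>: such prefixes do not occur in \<open>P\<close>, nor within the patterns of its update prefixes.\<close>

fun no_inert :: "'n cstr set \<Rightarrow> 'n trm \<Rightarrow> bool"
  and no_inert_pre :: "'n cstr set \<Rightarrow> 'n prefix \<Rightarrow> bool"
where
  "no_inert S Hole \<longleftrightarrow> True"
| "no_inert S Star \<longleftrightarrow> True"
| "no_inert S (Loc a P) \<longleftrightarrow> no_inert S P"
| "no_inert S (Par P Q) \<longleftrightarrow> no_inert S P \<and> no_inert S Q"
| "no_inert S (Sum M) \<longleftrightarrow> (\<forall>(p, P)\<in>set_mset M. no_inert_pre S p \<and> no_inert S P)"
| "no_inert S (Rep p P) \<longleftrightarrow> no_inert_pre S p \<and> no_inert S P"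
| "no_inert_pre S (In a) \<longleftrightarrow> True"
| "no_inert_pre S (Out a) \<longleftrightarrow> True"
| "no_inert_pre S (Upd a (Par (Loc b U) A)) \<longleftrightarrow>
     \<not> C4 U \<and> \<not> (C3 U \<and> S \<down> a = {}) \<and> no_inert S U \<and> no_inert S A"
| "no_inert_pre S (Upd a U) \<longleftrightarrow> True"

end

theory Submission
  imports Defs
begin

text \<open>
  An update \<open>Upd a (Par (Loc a U) A)\<close> of a located process \<open>Loc a R\<close> is admitted by \<open>\<rightarrow>\<^sub>s\<close> iff it
  preserves the containment structure and, if a hole of \<open>U\<close> is under a prefix, \<open>R\<close> has no locations.
  Since the number of locations of \<open>fill U R\<close> is that of \<open>U\<close> plus one copy of that of \<open>R\<close> for each
  hole of \<open>U\<close> not under a prefix, this always fails in case C4; it means that \<open>R\<close> has no locations in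
  case C2, it always holds in case C3, and in case C1 it says that \<open>R\<close> and \<open>U\<close> have equal structures.
  The names \<open>\<phi> (CStr (Loc a R))\<close> express precisely this as a synchronisation condition.  As reductions
  preserve containment structures, they also preserve the names of the enclosing locations, so encoding
  and transitions commute.

  For the converse on processes themselves, the encoding is decoded: the name and location pattern of
  an encoded update prefix determine the prefix, and a member of the sum or product that encodes a
  prefix of case C3 determines the whole family.
\<close>

section \<open>The grammar\<close>

lemma es_A_simps [simp]:
  "es_A h Hole \<longleftrightarrow> h"
  "\<not> es_A h Star"
  "\<not> es_A h (Loc a P)"
  "es_A h (Par P Q) \<longleftrightarrow> es_A h P \<and> es_A h Q"
  "es_A h (Sum M) \<longleftrightarrow> (\<forall>(p, A)\<in>#M. es_pre p \<and> es_A h A)"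
  "es_A h (Rep p A) \<longleftrightarrow> es_pre p \<and> es_A h A"
  by (auto elim: es_A.cases intro: es_P_es_A_es_pre.intros)

text \<open>\<open>P_Par\<close> and \<open>P_A\<close> overlap on parallel compositions; both
  readings agree because \<open>es_A\<close> implies \<open>es_P\<close>.\<close>

lemma es_P_simps [simp]:
  "es_P h Hole \<longleftrightarrow> h"
  "\<not> es_P h Star"
  "es_P h (Loc a P) \<longleftrightarrow> es_P h P"
  "es_P h (Par P Q) \<longleftrightarrow> es_P h P \<and> es_P h Q"
  "es_P h (Sum M) \<longleftrightarrow> (\<forall>(p, A)\<in>#M. es_pre p \<and> es_A h A)"
  "es_P h (Rep p A) \<longleftrightarrow> es_pre p \<and> es_A h A"
  by (auto simp: es_P.simps[of h Hole] es_P.simps[of h Star] es_P.simps[of h "Loc _ _"]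
      es_P.simps[of h "Par _ _"] es_P.simps[of h "Sum _"] es_P.simps[of h "Rep _ _"] intro: P_A)

lemma es_pre_Upd [simp]:
  "es_pre (Upd a W) \<longleftrightarrow> (\<exists>U A. W = Par (Loc a U) A \<and> es_P True U \<and> es_A False A)"
  by (auto simp: es_pre.simps)

lemma es_pre_In_Out [simp]: "es_pre (In a)" "es_pre (Out a)"
  by (auto intro: es_P_es_A_es_pre.intros)

lemma es_A_mono: "es_A h U \<Longrightarrow> es_A True U"
  \<comment> \<open>\<open>numholes.induct\<close> serves as structural induction on terms that does
    not enter prefixes; its cases 3 to 6 are \<open>Loc\<close>, \<open>Par\<close>,
    \<open>Sum\<close> and \<open>Rep\<close>.\<close>
  by (induction U rule: numholes.induct) auto

lemma es_P_mono: "es_P h U \<Longrightarrow> es_P True U"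
  by (induction U rule: numholes.induct) (auto intro: es_A_mono)

lemma es_A_numap: "es_A h A \<Longrightarrow> numap A = 0"
  by (induction A rule: numholes.induct) auto

lemma es_P_numap_0: "es_P h P \<Longrightarrow> numap P = 0 \<Longrightarrow> es_A h P"
  by (induction P rule: numholes.induct) auto

lemma children_eq_empty: "children P = {#} \<longleftrightarrow> numap P = 0"
  by (induction P rule: numap.induct) auto

lemma es_A_numholes: "es_A False A \<Longrightarrow> numholes A = 0"
  by (induction A rule: numholes.induct) (auto intro!: sum_mset.neutral)

lemma es_A_no_holes: "es_A h A \<Longrightarrow> numholes A = 0 \<Longrightarrow> es_A False A"
  by (induction A rule: numholes.induct) (fastforce simp: sum_mset_0_iff)+

lemma numph_le_numholes: "numph U \<le> numholes U"
  by (induction U rule: numholes.induct) auto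

section \<open>Filling holes and replacing the placeholder\<close>

lemma fill_no_holes: "numholes U = 0 \<Longrightarrow> fill U Q = U"
proof (induction U rule: numholes.induct)
  case (5 M)
  then have "image_mset (\<lambda>(p, U). (p, fill U Q)) M = image_mset id M"
    by (intro image_mset_cong) (fastforce simp: sum_mset_0_iff)
  then show ?case by simp
qed auto

lemma subst_star_es_A: "es_A h P \<Longrightarrow> subst_star X P = P"
proof (induction P rule: numholes.induct)
  case (5 M)
  then have "image_mset (\<lambda>(p, U). (p, subst_star X U)) M = image_mset id M"
    by (intro image_mset_cong) fastforce
  then show ?case by simp
qed auto

lemma subst_star_es_P: "es_P h P \<Longrightarrow> subst_star X P = P"
proof (induction P rule: numholes.induct)
  case (5 M)
  then show ?case by (metis es_A_simps(5) es_P_simps(5) subst_star_es_A)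
qed (auto simp: subst_star_es_A)

lemma es_A_fill: "es_A True U \<Longrightarrow> es_A False R \<Longrightarrow> es_A False (fill U R)"
  by (induction U rule: numholes.induct) auto

text \<open>Only terms of the second category may stand below a prefix. If a hole occurs there,
  \<open>R\<close> has no locations and so belongs to that category; otherwise the bodies of
  prefixes are unchanged by filling.\<close>

lemma es_P_fill:
  assumes "es_P True U" "es_P False R" "numph U > 0 \<longrightarrow> numap R = 0"
  shows "es_P False (fill U R)"
  using assms
proof (induction U rule: numholes.induct)
  case (5 M)
  have "es_A False (fill A R)" if "(p, A) \<in># M" for p A
  proof (cases "numph (Sum M) > 0")
    case True
    with 5 have "es_A False R" by (auto intro: es_P_numap_0)
    with 5 that show ?thesis by (auto intro!: es_A_fill)
  next
    case False
    with that have "numholes A = 0" by (fastforce simp: sum_mset_0_iff)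
    with 5 that show ?thesis by (auto simp: fill_no_holes intro!: es_A_no_holes)
  qed
  with 5 show ?case by auto
next
  case (6 p A)
  have "es_A False R" if "numap R = 0"
    using 6 that by (auto intro: es_P_numap_0)
  with 6 show ?case
    by (cases "numholes A = 0") (auto simp: fill_no_holes intro!: es_A_no_holes es_A_fill)
qed auto

text \<open>The difference counts the holes outside prefixes. As no location encloses them, each
  contributes its own copy of the children of \<open>R\<close> at the top level.\<close>

lemma children_fill:
  "numap U = 0 \<Longrightarrow> children (fill U R) = repeat_mset (numholes U - numph U) (children R)"
proof (induction U rule: numholes.induct)
  case (4 U V)
  then show ?case using numph_le_numholes[of U] numph_le_numholes[of V]
    by (simp flip: repeat_mset_distrib)
qed auto

lemma numap_fill: "numap (fill U R) = numap U + (numholes U - numph U) * numap R"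
proof (induction U rule: numholes.induct)
  case (4 U V)
  then show ?case using numph_le_numholes[of U] numph_le_numholes[of V]
    by (simp flip: add_mult_distrib)
qed auto

section \<open>Structural congruence\<close>

declare cong_trans [trans]

lemma cong_left_comm: "Par P (Par Q R) \<equiv>\<^sub>p Par Q (Par P R)"
  by (meson cong_Par cong_assoc cong_comm cong_refl cong_sym cong_trans)

lemma size_Sum:
  assumes "(p, U) \<in># M"
  shows "size p < size (Sum M)" "size U < size (Sum M)"
proof -
  obtain N where "M = add_mset (p, U) N" using assms by (metis mset_add)
  then show "size p < size (Sum M)" "size U < size (Sum M)" by simp_all
qed

lemma par_list_Cons: "xs \<noteq> [] \<Longrightarrow> par_list (x # xs) = Par x (par_list xs)"
  by (cases xs) auto

text \<open>\<open>Nil_proc\<close> is not a unit of parallel composition under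
  \<open>\<equiv>\<^sub>p\<close>, so empty lists have to be excluded.\<close>

lemma par_list_append:
  "xs \<noteq> [] \<Longrightarrow> ys \<noteq> [] \<Longrightarrow> par_list (xs @ ys) \<equiv>\<^sub>p Par (par_list xs) (par_list ys)"
proof (induction xs rule: par_list.induct)
  case (2 x)
  then show ?case by (simp add: par_list_Cons cong_refl)
next
  case (3 x y xs)
  then show ?case
    by simp (meson cong_Par cong_assoc cong_refl cong_trans)
qed simp

lemma par_list_move:
  assumes "as @ bs \<noteq> []"
  shows "par_list (as @ x # bs) \<equiv>\<^sub>p Par x (par_list (as @ bs))"
proof (cases "as = [] \<or> bs = []")
  case True
  with assms show ?thesis
    using par_list_append[of as "[x]"]
    by (cases "as = []") (auto simp: par_list_Cons cong_refl intro: cong_trans[OF _ cong_comm])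
next
  case False
  then have "par_list (as @ x # bs) \<equiv>\<^sub>p Par (par_list as) (Par x (par_list bs))"
    using par_list_append[of as "x # bs"] by (simp add: par_list_Cons)
  also have "\<dots> \<equiv>\<^sub>p Par (Par (par_list as) x) (par_list bs)"
    by (rule cong_assoc)
  also have "\<dots> \<equiv>\<^sub>p Par (Par x (par_list as)) (par_list bs)"
    by (intro cong_Par cong_comm cong_refl)
  also have "\<dots> \<equiv>\<^sub>p Par x (Par (par_list as) (par_list bs))"
    by (rule cong_sym, rule cong_assoc)
  also have "\<dots> \<equiv>\<^sub>p Par x (par_list (as @ bs))"
    using False by (intro cong_Par cong_refl cong_sym[OF par_list_append]) auto
  finally show ?thesis .
qed

lemma par_list_perm: "mset xs = mset ys \<Longrightarrow> par_list xs \<equiv>\<^sub>p par_list ys"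
proof (induction ys arbitrary: xs)
  case (Cons y ys)
  then have "y \<in> set xs" by (metis list.set_intros(1) set_mset_mset)
  then obtain as bs where xs: "xs = as @ y # bs" by (auto simp: in_set_conv_decomp)
  with Cons have m: "mset (as @ bs) = mset ys" by simp
  show ?case
  proof (cases "ys = []")
    case True
    with m xs show ?thesis by (simp add: cong_refl)
  next
    case False
    with m have "as @ bs \<noteq> []" by auto
    then have "par_list xs \<equiv>\<^sub>p Par y (par_list (as @ bs))"
      unfolding xs by (rule par_list_move)
    also have "\<dots> \<equiv>\<^sub>p Par y (par_list ys)"
      by (intro cong_Par cong_refl Cons.IH m)
    finally show ?thesis using False by (simp add: par_list_Cons)
  qed
qed (simp add: cong_refl)

lemma par_list_cong: "list_all2 scong xs ys \<Longrightarrow> par_list xs \<equiv>\<^sub>p par_list ys"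
proof (induction xs ys rule: list_all2_induct)
  case (Cons x xs y ys)
  then show ?case
    by (cases xs; cases ys) (auto intro: cong_Par)
qed (simp add: cong_refl)

text \<open>\<open>cong_Sum\<close> rewrites one summand at a time; the arbitrary remainder
  \<open>N\<close> absorbs those already rewritten.\<close>

lemma Sum_cong:
  "list_all2 (\<lambda>(p, U) (q, V). p = q \<and> U \<equiv>\<^sub>p V) xs ys \<Longrightarrow> Sum (mset xs + N) \<equiv>\<^sub>p Sum (mset ys + N)"
proof (induction xs ys arbitrary: N rule: list_all2_induct)
  case (Cons x xs y ys)
  then obtain p U V where xy: "x = (p, U)" "y = (p, V)" "U \<equiv>\<^sub>p V" by (cases x, cases y) auto
  have "Sum (mset (x # xs) + N) \<equiv>\<^sub>p Sum (add_mset (p, V) (mset xs + N))"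
    using xy by (simp add: cong_Sum)
  also have "\<dots> \<equiv>\<^sub>p Sum (mset ys + add_mset y N)"
    using Cons.IH[of "add_mset y N"] xy by simp
  finally show ?case by simp
qed (simp add: cong_refl)

section \<open>A complete invariant of structural congruence\<close>

text \<open>Multisets replace nested parallel compositions, which makes commutativity and
  associativity equalities. Prefixes stay unchanged, since \<open>\<equiv>\<^sub>p\<close> does not
  reach into them.\<close>

datatype 'n component =
    HoleC
  | StarC
  | LocC 'n "'n component multiset"
  | SumC "('n prefix \<times> 'n component multiset) multiset"
  | RepC "'n prefix" "'n component multiset"

fun components :: "'n trm \<Rightarrow> 'n component multiset" where
  "components Hole = {#HoleC#}"
| "components Star = {#StarC#}"
| "components (Loc a P) = {#LocC a (components P)#}"
| "components (Par P Q) = components P + components Q"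
| "components (Sum M) = {#SumC (image_mset (\<lambda>(p, P). (p, components P)) M)#}"
| "components (Rep p P) = {#RepC p (components P)#}"

lemma components_nonempty [simp]: "components P \<noteq> {#}"
  by (induction P rule: components.induct) auto

lemma scong_imp_components_eq: "P \<equiv>\<^sub>p Q \<Longrightarrow> components P = components Q"
  by (induction rule: scong.induct) auto

fun factors :: "'n trm \<Rightarrow> 'n trm list" where
  "factors (Par P Q) = factors P @ factors Q"
| "factors P = [P]"

lemma factors_nonempty [simp]: "factors P \<noteq> []"
  by (induction P rule: factors.induct) auto

lemma scong_par_list_factors: "P \<equiv>\<^sub>p par_list (factors P)"
proof (induction P rule: factors.induct)
  case (1 P Q)
  then show ?case
    by simp (meson cong_Par cong_sym cong_trans factors_nonempty par_list_append)
qed (auto simp: cong_refl)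

lemma factors_not_Par: "X \<in> set (factors P) \<Longrightarrow> X \<noteq> Par Q R"
  by (induction P rule: factors.induct) auto

lemma size_factors: "X \<in> set (factors P) \<Longrightarrow> size X \<le> size P"
  by (induction P rule: factors.induct) auto

lemma components_factors: "components P = (\<Sum>X\<in>#mset (factors P). components X)"
  by (induction P rule: factors.induct) auto

lemma components_factor: "X \<in> set (factors P) \<Longrightarrow> \<exists>c. components X = {#c#}"
  by (induction P rule: factors.induct) auto

text \<open>Families \<open>f x\<close> and \<open>f y\<close> that share an element are equal, so
  an element of \<open>f x\<close> locates a partner \<open>y\<close> in \<open>N\<close> whose
  whole family can be cancelled. This recovers indices from a union of families, as needed to decode
  sums and products.\<close>

lemma sum_mset_image_eq_cancel:
  assumes "\<And>x. x \<in># M + N \<Longrightarrow> f x \<noteq> {#}"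
    and "\<And>x y b. x \<in># M \<Longrightarrow> y \<in># N \<Longrightarrow> b \<in># f x \<Longrightarrow> b \<in># f y \<Longrightarrow> g x = g y \<and> f x = f y"
    and "(\<Sum>x\<in>#M. f x) = (\<Sum>x\<in>#N. f x)"
  shows "image_mset g M = image_mset g N"
  using assms
proof (induction M arbitrary: N)
  case empty
  then show ?case by (cases N) auto
next
  case (add x M)
  obtain b where b: "b \<in># f x" using add.prems(1)[of x] by auto
  then have "b \<in># (\<Sum>x\<in>#N. f x)" using add.prems(3) by (metis image_mset_add_mset sum_mset.insert union_iff)
  then obtain y where y: "y \<in># N" "b \<in># f y" by auto
  with b add.prems(2)[of x y b] have xy: "g x = g y" "f x = f y" by auto
  obtain N' where N': "N = add_mset y N'" using y by (metis mset_add)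
  have "image_mset g M = image_mset g N'"
  proof (rule add.IH)
    show "(\<Sum>x\<in>#M. f x) = (\<Sum>x\<in>#N'. f x)" using add.prems(3) N' xy by simp
  qed (use add.prems(1,2) N' in auto)
  with N' xy show ?case by simp
qed

lemma image_mset_eq_obtain_lists:
  assumes "image_mset f M = image_mset g N"
  obtains xs ys where "mset xs = M" "mset ys = N" "list_all2 (\<lambda>x y. f x = g y) xs ys"
proof -
  have "rel_mset (\<lambda>x y. f x = g y) M N"
    using assms by (simp add: multiset.rel_map flip: multiset.rel_eq)
  then show thesis using that by (auto simp: rel_mset_def)
qed

text \<open>Each factor has exactly one component, so equal multisets of components pair the factors
  of \<open>P\<close> and \<open>Q\<close>. Paired factors have the same top constructor, and their
  immediate subterms are smaller than \<open>P\<close>.\<close>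

lemma components_eq_imp_scong: "components P = components Q \<Longrightarrow> P \<equiv>\<^sub>p Q"
proof (induction P arbitrary: Q rule: measure_induct_rule[of size])
  case (less P)
  have factor: "X \<equiv>\<^sub>p Y"
    if X: "X \<in> set (factors P)" and Y: "Y \<in> set (factors Q)" and eq: "components X = components Y" for X Y
  proof -
    note IH = less.IH[OF less_le_trans[OF _ size_factors[OF X]]]
    have par: "X \<noteq> Par U V" "Y \<noteq> Par U V" for U V
      using X Y by (auto dest: factors_not_Par)
    show ?thesis
    proof (cases X)
      case (Sum M)
      with eq par obtain N where N: "Y = Sum N"
        and MN: "image_mset (\<lambda>(p, P). (p, components P)) M = image_mset (\<lambda>(p, P). (p, components P)) N"
        by (cases Y) auto
      from image_mset_eq_obtain_lists[OF MN] obtain xs ys where xs: "mset xs = M" and ys: "mset ys = N"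
        and all: "list_all2 (\<lambda>x y. (case x of (p, P) \<Rightarrow> (p, components P)) = (case y of (p, P) \<Rightarrow> (p, components P))) xs ys" .
      have "list_all2 (\<lambda>(p, U) (q, V). p = q \<and> U \<equiv>\<^sub>p V) xs ys"
      proof (rule list.rel_mono_strong[OF all], clarsimp)
        fix p U V assume "(p, U) \<in> set xs" and UV: "components U = components V"
        then have "(p, U) \<in># M" using xs by auto
        then have "size U < size X" using Sum by (simp only: size_Sum)
        then show "U \<equiv>\<^sub>p V" using UV by (rule IH)
      qed
      from Sum_cong[OF this, of "{#}"] show ?thesis using Sum N xs ys by simp
    qed (use eq par IH in \<open>cases Y; force intro: scong.intros\<close>)+
  qed
  have "image_mset components (mset (factors P)) = image_mset components (mset (factors Q))"
  proof (rule sum_mset_image_eq_cancel[where f = components])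
    show "(\<Sum>x\<in>#mset (factors P). components x) = (\<Sum>x\<in>#mset (factors Q). components x)"
      using less.prems by (simp flip: components_factors)
    show "components x \<noteq> {#}" for x
      by (rule components_nonempty)
    show "components x = components y \<and> components x = components y"
      if "x \<in># mset (factors P)" "y \<in># mset (factors Q)" "b \<in># components x" "b \<in># components y" for x y b
      using that components_factor[of x P] components_factor[of y Q] by auto
  qed
  from image_mset_eq_obtain_lists[OF this] obtain xs ys where
    xs: "mset xs = mset (factors P)" and ys: "mset ys = mset (factors Q)"
    and all: "list_all2 (\<lambda>x y. components x = components y) xs ys" .
  have "list_all2 scong xs ys"
    by (rule list.rel_mono_strong[OF all])
      (use factor mset_eq_setD[OF xs] mset_eq_setD[OF ys] in auto)
  then have "par_list xs \<equiv>\<^sub>p par_list ys" by (rule par_list_cong)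
  then show ?case
    by (meson cong_sym cong_trans par_list_perm scong_par_list_factors xs ys)
qed

section \<open>Transitions\<close>

lemma fill_par_list: "fill (par_list xs) Q = par_list (map (\<lambda>P. fill P Q) xs)"
  by (induction xs rule: par_list.induct) auto

lemma subst_star_par_list: "subst_star X (par_list xs) = par_list (map (subst_star X) xs)"
  by (induction xs rule: par_list.induct) auto

lemma numholes_par_list: "numholes (par_list xs) = (\<Sum>P\<leftarrow>xs. numholes P)"
  by (induction xs rule: par_list.induct) auto

lemma image_mset_sum_mset: "image_mset f (\<Sum>x\<in>#M. g x) = (\<Sum>x\<in>#M. image_mset f (g x))"
  by (induction M) auto

lemma set_enum_set: "finite X \<Longrightarrow> set (enum_set X) = X"
  unfolding enum_set_def using someI_ex[OF finite_distinct_list[of X, simplified conj_commute]] by blast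

lemma scong_imp_CStr_eq: "P \<equiv>\<^sub>p Q \<Longrightarrow> CStr P = CStr Q"
  by (induction rule: scong.induct) (auto simp: CStr_def)

inductive_cases step_HoleE: "step c Hole l Q"
inductive_cases step_StarE: "step c Star l Q"
inductive_cases step_LocE: "step c (Loc a P) l Q"
inductive_cases step_SumE: "step c (Sum M) l Q"
inductive_cases step_RepE: "step c (Rep p P) l Q"

lemma step_Par_cases [consumes 1, case_names ParL ParR SynL SynR UpdL UpdR]:
  assumes "step c (Par P Q) l D"
  obtains P' where "D = Par P' Q" "step c P l P'"
    | Q' where "D = Par P Q'" "step c Q l Q'"
    | a P' Q' where "l = Tau" "D = Par P' Q'" "step c P (Pre (In a)) P'" "step c Q (Pre (Out a)) Q'"
    | a P' Q' where "l = Tau" "D = Par P' Q'" "step c P (Pre (Out a)) P'" "step c Q (Pre (In a)) Q'"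
    | a R P' U Q' where "l = Tau" "D = Par (subst_star (fill U R) P') Q'"
        "step c P (Located a R) P'" "step c Q (Pre (Upd a U)) Q'" "c U R"
    | a U P' R Q' where "l = Tau" "D = Par P' (subst_star (fill U R) Q')"
        "step c P (Pre (Upd a U)) P'" "step c Q (Located a R) Q'" "c U R"
  using assms by (cases rule: step.cases) blast+

text \<open>The body \<open>V\<close> appears next to the member that fired and has to be moved to
  the front, hence the congruence.\<close>

lemma step_par_list_Rep:
  assumes "q \<in> set qs"
  shows "\<exists>D. step c (par_list (map (\<lambda>q. Rep q V) qs)) (Pre q) D \<and>
    D \<equiv>\<^sub>p Par V (par_list (map (\<lambda>q. Rep q V) qs))"
  using assms
proof (induction qs)
  case (Cons q' qs')
  let ?L = "par_list (map (\<lambda>q. Rep q V) qs')"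
  show ?case
  proof (cases "qs' = []")
    case True
    with Cons show ?thesis by (auto intro!: exI[of _ "Par V (Rep q V)"] s_Rep cong_refl)
  next
    case nonempty: False
    then have whole: "par_list (map (\<lambda>q. Rep q V) (q' # qs')) = Par (Rep q' V) ?L"
      by (simp add: par_list_Cons)
    show ?thesis
    proof (cases "q = q'")
      case True
      then have "step c (Par (Rep q' V) ?L) (Pre q) (Par (Par V (Rep q' V)) ?L)"
        by (auto intro: s_ParL s_Rep)
      then show ?thesis unfolding whole by (meson cong_assoc cong_sym)
    next
      case False
      with Cons(2) have "q \<in> set qs'" by simp
      from Cons(1)[OF this] obtain D where D: "step c ?L (Pre q) D" "D \<equiv>\<^sub>p Par V ?L" by auto
      have "Par (Rep q' V) D \<equiv>\<^sub>p Par (Rep q' V) (Par V ?L)"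
        using D by (intro cong_Par cong_refl)
      also have "\<dots> \<equiv>\<^sub>p Par V (Par (Rep q' V) ?L)" by (rule cong_left_comm)
      finally show ?thesis unfolding whole using D by (meson s_ParR)
    qed
  qed
qed simp

text \<open>Members of the product cannot interact: the second hypothesis rules out communication,
  and an update would need a \<open>Located\<close> label, which no replication offers.\<close>

lemma step_par_list_RepD:
  assumes "step c (par_list (map (\<lambda>q. Rep q V) qs)) l D"
    and "\<And>a. \<not> (In a \<in> set qs \<and> Out a \<in> set qs)"
  shows "\<exists>q\<in>set qs. l = Pre q \<and> D \<equiv>\<^sub>p Par V (par_list (map (\<lambda>q. Rep q V) qs))"
  using assms
proof (induction qs arbitrary: l D)
  case Nil
  then show ?case by (auto elim: step_SumE)
next
  case (Cons q' qs')
  let ?L = "par_list (map (\<lambda>q. Rep q V) qs')"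
  have IH: "\<exists>q\<in>set qs'. l = Pre q \<and> D \<equiv>\<^sub>p Par V ?L" if "step c ?L l D" for l D
    using Cons(1)[OF that] Cons(3) by auto
  have left: "l = Pre q' \<and> D = Par V (Rep q' V)" if "step c (Rep q' V) l D" for l D
    using that by (auto elim: step_RepE)
  show ?case
  proof (cases "qs' = []")
    case True
    with Cons(2) left show ?thesis by (auto intro: cong_refl)
  next
    case False
    then have whole: "par_list (map (\<lambda>q. Rep q V) (q' # qs')) = Par (Rep q' V) ?L"
      by (simp add: par_list_Cons)
    from Cons(2) have "step c (Par (Rep q' V) ?L) l D" unfolding whole .
    then show ?thesis
    proof (cases rule: step_Par_cases)
      case (ParL P')
      with left have "l = Pre q'" "D = Par (Par V (Rep q' V)) ?L" by auto
      then show ?thesis unfolding whole by (auto intro: cong_sym[OF cong_assoc])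
    next
      case (ParR Q')
      then obtain q where q: "q \<in> set qs'" "l = Pre q" "Q' \<equiv>\<^sub>p Par V ?L" using IH by blast
      have "Par (Rep q' V) Q' \<equiv>\<^sub>p Par (Rep q' V) (Par V ?L)"
        using q by (intro cong_Par cong_refl)
      also have "\<dots> \<equiv>\<^sub>p Par V (Par (Rep q' V) ?L)" by (rule cong_left_comm)
      finally show ?thesis unfolding whole using ParR q by auto
    next
      case (SynL a P' Q')
      then show ?thesis using left IH Cons(3)[of a] by fastforce
    next
      case (SynR a P' Q')
      then show ?thesis using left IH Cons(3)[of a] by fastforce
    next
      case (UpdL a R P' U Q')
      then show ?thesis using left by blast
    next
      case (UpdR a U P' R Q')
      then show ?thesis using IH by blast
    qed
  qed
qed

section \<open>Invariants of transitions\<close>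

text \<open>The children are preserved because the body released by a prefix is of the second
  category and has no locations outside prefixes.\<close>

lemma step_Pre_es:
  assumes "step c P (Pre p) P'" and "es_process P"
  shows "es_pre p" "es_process P'" "children P' = children P"
proof -
  have "es_pre p \<and> es_process P' \<and> children P' = children P"
    using assms
    by (induction P "Pre p :: 'a label" P' rule: step.induct)
      (auto simp: children_eq_empty intro: es_A_numap P_A)
  then show "es_pre p" "es_process P'" "children P' = children P" by auto
qed

lemma step_Pre_no_inert:
  assumes "step c P (Pre p) P'" and "no_inert S P"
  shows "no_inert_pre S p" "no_inert S P'"
proof -
  have "no_inert_pre S p \<and> no_inert S P'"
    using assms by (induction P "Pre p :: 'a label" P' rule: step.induct) auto
  then show "no_inert_pre S p" "no_inert S P'" by auto
qed

text \<open>The residual \<open>P'\<close> contains the placeholder and so lies outside the grammar;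
  its invariants are stated after substitution. Membership in \<open>CStrs P\<close> later places
  the name of the updated location in the image of \<open>S\<close>.\<close>

lemma step_Located_es:
  assumes "step c P (Located a R) P'" and "es_process P"
  shows "es_process R" "CStr (Loc a R) \<in> CStrs P"
    "es_process X \<Longrightarrow> es_process (subst_star X P')"
    "children X = children (Loc a R) \<Longrightarrow> children (subst_star X P') = children P"
proof -
  have "es_process R \<and> CStr (Loc a R) \<in> CStrs P \<and> (es_process X \<longrightarrow> es_process (subst_star X P')) \<and>
    (children X = children (Loc a R) \<longrightarrow> children (subst_star X P') = children P)"
    using assms
    by (induction P "Located a R" P' rule: step.induct) (auto simp: subst_star_es_P)
  then show "es_process R" "CStr (Loc a R) \<in> CStrs P"
    "es_process X \<Longrightarrow> es_process (subst_star X P')"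
    "children X = children (Loc a R) \<Longrightarrow> children (subst_star X P') = children P"
    by auto
qed

lemma step_Located_no_inert:
  assumes "step c P (Located a R) P'" and "es_process P" and "no_inert S P"
  shows "no_inert S R" "no_inert S X \<Longrightarrow> no_inert S (subst_star X P')"
proof -
  have "no_inert S R \<and> (no_inert S X \<longrightarrow> no_inert S (subst_star X P'))"
    using assms
    by (induction P "Located a R" P' rule: step.induct) (auto simp: subst_star_es_P)
  then show "no_inert S R" "no_inert S X \<Longrightarrow> no_inert S (subst_star X P')" by auto
qed

lemma no_inert_fill: "no_inert S U \<Longrightarrow> no_inert S R \<Longrightarrow> no_inert S (fill U R)"
  by (induction U rule: numholes.induct) auto

lemma es_A_numph: "es_A False A \<Longrightarrow> numph A = 0"
  using numph_le_numholes[of A] es_A_numholes[of A] by simp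

text \<open>The process \<open>A\<close> is of the second category, so it contributes neither
  children nor holes and the condition concerns \<open>U\<close> alone.\<close>

lemma cond_s_iff:
  assumes "es_A False A"
  shows "cond_s (Par (Loc b U) A) R \<longleftrightarrow>
    children (fill U R) = children R \<and> (numph U > 0 \<longrightarrow> numap R = 0)"
  using assms es_A_numap[of False A] by (auto simp: cond_s_def CStr_def es_A_numph simp flip: children_eq_empty)

lemma cond_s_fill:
  assumes "cond_s W R" "es_pre (Upd b W)" "es_process R"
  shows "es_process (fill W R)" "children (fill W R) = children (Loc b R)"
proof -
  obtain U A where W: "W = Par (Loc b U) A" and U: "es_P True U" and A: "es_A False A"
    using assms(2) by auto
  have "fill A R = A" "children A = {#}"
    using A by (simp_all add: fill_no_holes es_A_numholes children_eq_empty es_A_numap)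
  then show "es_process (fill W R)" "children (fill W R) = children (Loc b R)"
    using assms(1,3) U A unfolding W by (auto simp: cond_s_iff intro: es_P_fill P_A)
qed

text \<open>Updates are the only transitions that could alter the containment structure, and
  \<open>cond_s\<close> makes the replacement have the children of the location it replaces.\<close>

lemma step_s_Tau_es:
  assumes "step cond_s P Tau P'" and "es_process P"
  shows "es_process P' \<and> children P' = children P \<and> (no_inert S P \<longrightarrow> no_inert S P')"
  using assms
proof (induction P "Tau :: 'a label" P' rule: step.induct)
  case (s_SynL P a P' Q Q')
  then show ?case by (auto simp: step_Pre_es step_Pre_no_inert dest: step_Pre_es)
next
  case (s_SynR P a P' Q Q')
  then show ?case by (auto simp: step_Pre_es step_Pre_no_inert dest: step_Pre_es)
next
  case (s_UpdL P a R P' Q U Q')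
  then have *: "es_process P" "es_process Q" by auto
  note P = step_Located_es[OF s_UpdL(1) *(1)] and Q = step_Pre_es[OF s_UpdL(2) *(2)]
  note f = cond_s_fill[OF s_UpdL(3) Q(1) P(1)]
  have "no_inert S (fill U R)" if "no_inert S (Par P Q)"
    using that step_Pre_no_inert(1)[OF s_UpdL(2)] step_Located_no_inert(1)[OF s_UpdL(1) *(1)] Q(1)
    by (auto intro!: no_inert_fill)
  then show ?case using P f Q step_Pre_no_inert(2)[OF s_UpdL(2)] step_Located_no_inert(2)[OF s_UpdL(1) *(1)]
    by auto
next
  case (s_UpdR P a U P' Q R Q')
  then have *: "es_process P" "es_process Q" by auto
  note P = step_Pre_es[OF s_UpdR(1) *(1)] and Q = step_Located_es[OF s_UpdR(2) *(2)]
  note f = cond_s_fill[OF s_UpdR(3) P(1) Q(1)]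
  have "no_inert S (fill U R)" if "no_inert S (Par P Q)"
    using that step_Pre_no_inert(1)[OF s_UpdR(1)] step_Located_no_inert(1)[OF s_UpdR(2) *(2)] P(1)
    by (auto intro!: no_inert_fill)
  then show ?case using P f Q step_Pre_no_inert(2)[OF s_UpdR(1)] step_Located_no_inert(2)[OF s_UpdR(2) *(2)]
    by auto
qed auto

lemma factors_es_P: "es_P h P \<Longrightarrow> X \<in> set (factors P) \<Longrightarrow> es_P h X"
  by (induction P rule: factors.induct) auto

lemma factors_no_inert: "no_inert S P \<Longrightarrow> X \<in> set (factors P) \<Longrightarrow> no_inert S X"
  by (induction P rule: factors.induct) auto

lemma components_par_list: "xs \<noteq> [] \<Longrightarrow> components (par_list xs) = (\<Sum>P\<in>#mset xs. components P)"
  by (induction xs rule: par_list.induct) auto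

section \<open>The encoding\<close>

lemma size_subtree [termination_simp]:
  assumes "(a, T) \<in># M"
  shows "size T < Suc (size_multiset (\<lambda>x. Suc (size (snd x))) M)"
proof -
  obtain N where "M = add_mset (a, T) N" using assms by (metis mset_add)
  then show ?thesis by simp
qed

text \<open>The number of nodes below the root; it shows that \<open>numap\<close> depends only on
  the containment structure.\<close>

fun nodes :: "'n cstr \<Rightarrow> nat" where
  "nodes (CNode M) = (\<Sum>(a, T)\<in>#M. Suc (nodes T))"

lemma numap_eq_nodes: "numap P = nodes (CNode (children P))"
  by (induction P rule: numap.induct) auto

text \<open>The last assumption lets \<open>enum_set\<close> enumerate the names of case
  \<open>C3\<close>, of which the encoding forms finite sums and products.\<close>

locale encoding =
  fixes S :: "'n cstr set" and \<phi> :: "'n cstr \<Rightarrow> 'n" and \<kappa> :: "'n \<Rightarrow> 'n" and err :: 'n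
  assumes inj_phi: "inj \<phi>"
    and phi_kappa: "numap Q = 0 \<Longrightarrow> \<phi> (CStr (Loc a Q)) = \<kappa> a"
    and err_notin: "err \<notin> \<phi> ` S"
    and finite_child_restr: "finite (S \<down> a)"
begin

abbreviation encode :: "'n trm \<Rightarrow> 'n trm" where
  "encode \<equiv> enc S \<phi> \<kappa> err"

abbreviation encode_pre :: "'n prefix \<Rightarrow> 'n prefix list" where
  "encode_pre \<equiv> enc_pre S \<phi> \<kappa> err"

lemma phi_Loc_eq_iff: "\<phi> (CStr (Loc a P)) = \<phi> (CStr (Loc b Q)) \<longleftrightarrow> a = b \<and> children P = children Q"
  by (simp add: inj_eq[OF inj_phi] CStr_def)

lemma kappa_eq_phi_iff: "\<phi> (CStr (Loc a P)) = \<kappa> b \<longleftrightarrow> a = b \<and> numap P = 0"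
proof -
  \<comment> \<open>\<open>Nil_proc\<close> is a sample process without locations, so
    \<open>\<kappa> b\<close> lies in the image of \<phi> and injectivity applies.\<close>
  have "\<kappa> b = \<phi> (CStr (Loc b Nil_proc))" by (simp add: phi_kappa)
  then show ?thesis by (simp add: phi_Loc_eq_iff children_eq_empty)
qed

lemma set_enum_child_restr [simp]: "set (enum_set (\<phi> ` (S \<down> a))) = \<phi> ` (S \<down> a)"
  by (simp add: set_enum_set finite_child_restr)

lemma phi_in_child_restr_iff:
  "\<phi> (CStr (Loc a P)) \<in> \<phi> ` (S \<down> b) \<longleftrightarrow> a = b \<and> CStr (Loc a P) \<in> S"
  by (auto simp: inj_image_mem_iff[OF inj_phi] child_restr_def CStr_def)

text \<open>Location names depend on the content, so filling below a location could change them. A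
  pattern of the second category has no locations outside prefixes, and filling leaves prefixes
  alone.\<close>

lemma encode_fill_es_A: "es_A True U \<Longrightarrow> fill (encode U) (encode Q) = encode (fill U Q)"
proof (induction U rule: numholes.induct)
  case (5 M)
  then have "fill (encode U) (encode Q) = encode (fill U Q)" if "(p, U) \<in># M" for p U
    using that by fastforce
  then show ?case
    by (auto simp: image_mset_sum_mset multiset.map_comp comp_def case_prod_beta
        intro!: arg_cong[where f = sum_mset] image_mset_cong)
qed (auto simp: fill_par_list comp_def)

text \<open>Only the absence of holes is transferred: in case \<open>C3\<close> the body is repeated
  once per name, which changes their number.\<close>

lemma numholes_encode: "numholes U = 0 \<Longrightarrow> numholes (encode U) = 0"
proof (induction U rule: numholes.induct)
  case (5 M)
  then show ?case by (fastforce simp: sum_mset_0_iff)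
qed (auto simp: numholes_par_list)

lemma subst_star_encode_es_A: "es_A h P \<Longrightarrow> subst_star X (encode P) = encode P"
proof (induction P rule: numholes.induct)
  case (5 M)
  then have "subst_star X (encode P) = encode P" if "(p, P) \<in># M" for p P
    using that by fastforce
  then show ?case
    by (auto simp: image_mset_sum_mset multiset.map_comp comp_def case_prod_beta
        intro!: arg_cong[where f = sum_mset] image_mset_cong)
qed (auto simp: subst_star_par_list comp_def)

lemma subst_star_encode: "es_P h P \<Longrightarrow> subst_star X (encode P) = encode P"
proof (induction P rule: numholes.induct)
  case (5 M)
  then show ?case by (metis es_A_simps(5) es_P_simps(5) subst_star_encode_es_A)
next
  case (6 p P)
  then show ?case by (metis es_A_simps(6) es_P_simps(6) subst_star_encode_es_A)
qed auto

text \<open>Congruent processes have equal containment structures, which fixes the location names;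
  under an unchanged prefix the members of the encoded family are related one by one.\<close>

lemma encode_scong: "P \<equiv>\<^sub>p Q \<Longrightarrow> encode P \<equiv>\<^sub>p encode Q"
proof (induction rule: scong.induct)
  case (cong_Loc P P' a)
  then show ?case
    using scong_imp_CStr_eq[OF scong.cong_Loc[OF cong_Loc(1), of a]] by (simp add: scong.cong_Loc)
next
  case (cong_Sum P P' p M)
  then show ?case by (auto intro!: Sum_cong simp: list_all2_conv_all_nth simp del: mset_map)
next
  case (cong_Rep P P' p)
  then show ?case by (auto intro!: par_list_cong scong.cong_Rep simp: list_all2_conv_all_nth)
qed (auto intro: scong.intros)

section \<open>The update condition as equality of names\<close>

lemma encode_upd:
  assumes "cond_s (Par (Loc b U) A) R" and "CStr (Loc b R) \<in> S"
    and "es_P True U" and "es_A False A" and "es_process R"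
  obtains V where "Upd (\<phi> (CStr (Loc b R))) V \<in> set (encode_pre (Upd b (Par (Loc b U) A)))"
proof -
  have ch: "children (fill U R) = children R" and ph: "numph U > 0 \<longrightarrow> numap R = 0"
    using assms by (auto simp: cond_s_iff)
  \<comment> \<open>Equal children give equal numbers of locations; this count settles
    \<open>C2\<close> and \<open>C4\<close>.\<close>
  have na: "numap U + (numholes U - numph U) * numap R = numap R"
    using ch by (metis numap_eq_nodes numap_fill)
  consider "C1 U" | "C2 U" | "C3 U" | "C4 U" using C_exhaustive by blast
  then show thesis
  proof cases
    case 1
    then have "children R = children U" using ch by (simp add: C1_def fill_no_holes)
    then have "\<phi> (CStr (Loc b R)) = \<phi> (CStr (Loc b U))" by (simp add: phi_Loc_eq_iff)
    then show thesis using 1 that by simp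
  next
    case 2
    \<comment> \<open>If \<open>R\<close> had locations, no hole would be under a prefix, so
      \<open>C2\<close> would leave at least two holes, each copying them.\<close>
    have "numap R = 0"
    proof (rule ccontr)
      assume "numap R \<noteq> 0"
      with ph na 2 show False by (auto simp: C2_def)
    qed
    then have "\<phi> (CStr (Loc b R)) = \<kappa> b" by (simp add: phi_kappa)
    then show thesis using 2 C_exclusive[of U] that by simp
  next
    case 3
    have "\<phi> (CStr (Loc b R)) \<in> \<phi> ` (S \<down> b)" using assms by (simp add: phi_in_child_restr_iff)
    then show thesis using 3 C_exclusive[of U] that by auto
  next
    case 4
    \<comment> \<open>If all holes are under prefixes, \<open>R\<close> has no locations and the
      count gives \<open>numap U = 0\<close>. Otherwise one copy of \<open>R\<close> already
      exhausts the count, with the same result.\<close>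
    then have False using na ph by (cases "numholes U - numph U") (auto simp: C4_def)
    then show thesis ..
  qed
qed

text \<open>Matching names imply the update condition: by injectivity of \<phi> the name yields the
  location label, in \<open>C1\<close> the structure of \<open>R\<close>, and in \<open>C2\<close>
  that \<open>R\<close> has no locations.\<close>

lemma decode_upd:
  assumes "Upd (\<phi> (CStr (Loc a R))) V \<in> set (encode_pre (Upd b (Par (Loc b U) A)))"
    and "CStr (Loc a R) \<in> S"
    and "es_P True U" and "es_A False A" and "es_process R"
  shows "a = b" "cond_s (Par (Loc b U) A) R"
    "fill V (encode R) = encode (fill (Par (Loc b U) A) R)"
proof -
  let ?k = "\<phi> (CStr (Loc a R))"
  \<comment> \<open>This excludes case \<open>C4\<close>, whose only name is
    \<open>err\<close>.\<close>
  have "?k \<noteq> err" using assms(2) err_notin by auto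
  have A: "fill A R = A" "fill (encode A) (encode R) = encode A"
    using assms(4) by (simp_all add: fill_no_holes es_A_numholes numholes_encode)
  have "a = b \<and> cond_s (Par (Loc b U) A) R \<and> V = Par (Loc ?k (encode U)) (encode A) \<and>
    fill (encode U) (encode R) = encode (fill U R)"
  proof -
    consider "C1 U" | "C2 U" | "C3 U" | "C4 U" using C_exhaustive by blast
    then show ?thesis
    proof cases
      case 1
      then have U: "numholes U = 0" "numph U = 0" using numph_le_numholes[of U] by (simp_all add: C1_def)
      then have "fill U R = U" "fill (encode U) (encode R) = encode U"
        by (simp_all add: fill_no_holes numholes_encode)
      with 1 U assms(1,4) show ?thesis by (auto simp: phi_Loc_eq_iff cond_s_iff)
    next
      case 2
      then have U: "numap U = 0" "es_A True U" using assms(3) by (auto simp: C2_def es_P_numap_0)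
      have *: "?k = \<kappa> b" "V = Par (Loc ?k (encode U)) (encode A)"
        using assms(1) 2 C_exclusive[of U] by auto
      then have "a = b" "numap R = 0" by (auto simp: kappa_eq_phi_iff)
      moreover from this have "children (fill U R) = children R"
        using U by (metis add_0 children_eq_empty mult_0_right numap_fill)
      ultimately show ?thesis using * U assms(4) by (auto simp: cond_s_iff encode_fill_es_A)
    next
      case 3
      then have U: "numap U = 0" "es_A True U" using assms(3) by (auto simp: C3_def es_P_numap_0)
      have *: "?k \<in> \<phi> ` (S \<down> b)" "V = Par (Loc ?k (encode U)) (encode A)"
        using assms(1) 3 C_exclusive[of U] by auto
      then have "a = b" by (simp add: phi_in_child_restr_iff)
      then show ?thesis using * U 3 assms(4)
        by (auto simp: cond_s_iff encode_fill_es_A children_fill C3_def)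
    next
      case 4
      then show ?thesis using assms(1) \<open>?k \<noteq> err\<close> C_exclusive[of U] by simp
    qed
  qed
  \<comment> \<open>By \<open>cond_s\<close>, filling preserves the children, so \<open>?k\<close>
    is also the name given to the filled location.\<close>
  then show "a = b" "cond_s (Par (Loc b U) A) R"
    "fill V (encode R) = encode (fill (Par (Loc b U) A) R)"
    using A assms(4) by (auto simp: cond_s_iff phi_Loc_eq_iff)
qed

lemma encode_pre_In_Out:
  "In a \<in> set (encode_pre p) \<longleftrightarrow> p = In a" "Out a \<in> set (encode_pre p) \<longleftrightarrow> p = Out a"
proof -
  have "(In a \<in> set (encode_pre p) \<longleftrightarrow> p = In a) \<and> (Out a \<in> set (encode_pre p) \<longleftrightarrow> p = Out a)"
  proof (cases p)
    case (Upd b W)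
    have "\<exists>k V. q = Upd k V" if "q \<in> set (encode_pre (Upd b W))" for q
    proof (cases "\<exists>c U A. W = Par (Loc c U) A")
      case True
      with that show ?thesis by (auto simp: Let_def split: if_splits)
    next
      case False
      then have "encode_pre (Upd b W) = [Upd b W]"
      proof (cases W)
        case (Par U A)
        with False show ?thesis by (cases U) auto
      qed auto
      with that show ?thesis by simp
    qed
    with Upd show ?thesis by blast
  qed auto
  then show "In a \<in> set (encode_pre p) \<longleftrightarrow> p = In a" "Out a \<in> set (encode_pre p) \<longleftrightarrow> p = Out a" by auto
qed

section \<open>Transitions of encodings\<close>

text \<open>The conditions \<open>c\<close> and \<open>d\<close> are arbitrary because transitions
  labelled by prefixes never consult them. Congruence enters through unfolded products.\<close>

lemma encode_step_Pre:
  assumes "step c P (Pre p) P'" and "es_process P" and "q \<in> set (encode_pre p)"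
  shows "\<exists>D. step d (encode P) (Pre q) D \<and> D \<equiv>\<^sub>p encode P'"
  using assms
proof (induction P "Pre p :: 'n label" P' rule: step.induct)
  case (s_Sum P M)
  then have "(q, encode P) \<in># (\<Sum>(p, U)\<in>#M. mset (map (\<lambda>q. (q, encode U)) (encode_pre p)))"
    by force
  then have "step d (encode (Sum M)) (Pre q) (encode P)"
    unfolding enc.simps by (rule step.s_Sum)
  then show ?case using cong_refl by blast
next
  case (s_Rep P)
  then show ?case using step_par_list_Rep[of q "encode_pre p" d "encode P"] by simp
next
  case (s_Loc P P' a)
  then have "\<phi> (CStr (Loc a P')) = \<phi> (CStr (Loc a P))"
    using step_Pre_es(3)[OF s_Loc(1)] by (simp add: CStr_def)
  with s_Loc show ?case by (auto intro: step.s_Loc cong_Loc)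
qed (auto intro: step.s_ParL step.s_ParR cong_Par cong_refl)

lemma decode_step_Pre:
  assumes "step d (encode P) (Pre q) D" and "es_process P"
  shows "\<exists>p P'. step c P (Pre p) P' \<and> q \<in> set (encode_pre p) \<and> D \<equiv>\<^sub>p encode P'"
  using assms
proof (induction P arbitrary: D rule: numholes.induct)
  case (3 a P)
  from 3(2) obtain D' where D: "D = Loc (\<phi> (CStr (Loc a P))) D'" and D': "step d (encode P) (Pre q) D'"
    by (auto elim: step_LocE)
  from 3 obtain p P' where P': "step c P (Pre p) P'" "q \<in> set (encode_pre p)" "D' \<equiv>\<^sub>p encode P'"
    using 3(1)[OF D'] by auto
  then have "\<phi> (CStr (Loc a P')) = \<phi> (CStr (Loc a P))"
    using step_Pre_es(3)[OF P'(1)] 3(3) by (simp add: CStr_def)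
  with P' D show ?case
    by (intro exI[of _ p] exI[of _ "Loc a P'"]) (auto intro: s_Loc cong_Loc)
next
  case (4 P Q)
  from 4(3) have "step d (Par (encode P) (encode Q)) (Pre q) D" by simp
  then show ?case
  proof (cases rule: step_Par_cases)
    case (ParL D')
    with 4 obtain p P' where P': "step c P (Pre p) P'" "q \<in> set (encode_pre p)" "D' \<equiv>\<^sub>p encode P'"
      by fastforce
    with ParL show ?thesis
      by (intro exI[of _ p] exI[of _ "Par P' Q"]) (auto intro: s_ParL cong_Par cong_refl)
  next
    case (ParR D')
    with 4 obtain p Q' where P': "step c Q (Pre p) Q'" "q \<in> set (encode_pre p)" "D' \<equiv>\<^sub>p encode Q'"
      by fastforce
    with ParR show ?thesis
      by (intro exI[of _ p] exI[of _ "Par P Q'"]) (auto intro: s_ParR cong_Par cong_refl)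
  qed auto
next
  case (5 M)
  then have "(q, D) \<in># (\<Sum>(p, U)\<in>#M. mset (map (\<lambda>q. (q, encode U)) (encode_pre p)))"
    by - (rule step_SumE[OF 5(2)[unfolded enc.simps]], simp)
  then obtain p U where "(p, U) \<in># M" "q \<in> set (encode_pre p)" "D = encode U" by auto
  then show ?case by (auto intro: s_Sum cong_refl)
next
  case (6 p U)
  from 6(2) have "step d (par_list (map (\<lambda>q. Rep q (encode U)) (encode_pre p))) (Pre q) D" by simp
  \<comment> \<open>By \<open>encode_pre_In_Out\<close>, a family containing both
    \<open>In a\<close> and \<open>Out a\<close> would encode two different prefixes at
    once.\<close>
  from step_par_list_RepD[OF this]
  have "q \<in> set (encode_pre p) \<and> D \<equiv>\<^sub>p Par (encode U) (encode (Rep p U))"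
    by (auto simp: encode_pre_In_Out)
  then show ?case by (intro exI[of _ p] exI[of _ "Par U (Rep p U)"]) (auto intro: s_Rep)
qed (auto elim: step_HoleE step_StarE)

text \<open>
  The names on the path to the placeholder depend on what is to be put there; the residuals of a
  process and of its encoding can be compared only after substitution.
\<close>

lemma encode_step_Located:
  assumes "step c P (Located a R) P'" and "es_process P"
  shows "\<exists>D. step d (encode P) (Located (\<phi> (CStr (Loc a R))) (encode R)) D \<and>
    (\<forall>X. children X = children (Loc a R) \<longrightarrow> subst_star (encode X) D = encode (subst_star X P'))"
  using assms
proof (induction P "Located a R" P' rule: step.induct)
  case s_Comp
  then show ?case by (auto intro!: exI[of _ Star] step.s_Comp)
next
  case (s_Loc P P' b)
  then obtain D where D: "step d (encode P) (Located (\<phi> (CStr (Loc a R))) (encode R)) D"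
    "\<And>X. children X = children (Loc a R) \<Longrightarrow> subst_star (encode X) D = encode (subst_star X P')"
    by auto
  \<comment> \<open>The enclosing location keeps its name for every admissible
    \<open>X\<close>.\<close>
  have "CStr (Loc b (subst_star X P')) = CStr (Loc b P)" if "children X = children (Loc a R)" for X
    using step_Located_es(4)[OF s_Loc(1) _ that] s_Loc(3) by (simp add: CStr_def)
  with D show ?case
    by (intro exI[of _ "Loc (\<phi> (CStr (Loc b P))) D"]) (auto intro: step.s_Loc)
next
  case (s_ParL P P' Q)
  then obtain D where D: "step d (encode P) (Located (\<phi> (CStr (Loc a R))) (encode R)) D"
    "\<And>X. children X = children (Loc a R) \<Longrightarrow> subst_star (encode X) D = encode (subst_star X P')"
    by auto
  with s_ParL(3) show ?case
    by (intro exI[of _ "Par D (encode Q)"]) (auto intro: step.s_ParL simp: subst_star_encode subst_star_es_P)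
next
  case (s_ParR Q Q' P)
  then obtain D where D: "step d (encode Q) (Located (\<phi> (CStr (Loc a R))) (encode R)) D"
    "\<And>X. children X = children (Loc a R) \<Longrightarrow> subst_star (encode X) D = encode (subst_star X Q')"
    by auto
  with s_ParR(3) show ?case
    by (intro exI[of _ "Par (encode P) D"]) (auto intro: step.s_ParR simp: subst_star_encode subst_star_es_P)
qed

lemma decode_step_Located:
  assumes "step d (encode P) (Located k V) D" and "es_process P"
  shows "\<exists>a R P'. step c P (Located a R) P' \<and> k = \<phi> (CStr (Loc a R)) \<and> V = encode R \<and>
    (\<forall>X. children X = children (Loc a R) \<longrightarrow> subst_star (encode X) D = encode (subst_star X P'))"
  using assms
proof (induction P arbitrary: D rule: numholes.induct)
  case (3 b P)
  from 3(2) have "step d (Loc (\<phi> (CStr (Loc b P))) (encode P)) (Located k V) D" by simp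
  then show ?case
  proof (cases rule: step.cases)
    case s_Comp
    then show ?thesis by - (rule exI[of _ b], rule exI[of _ P], rule exI[of _ Star], auto intro: step.s_Comp)
  next
    case (s_Loc D')
    with 3 obtain a R P' where P': "step c P (Located a R) P'" "k = \<phi> (CStr (Loc a R))" "V = encode R"
      and X: "\<And>X. children X = children (Loc a R) \<Longrightarrow> subst_star (encode X) D' = encode (subst_star X P')"
      by fastforce
    have "CStr (Loc b (subst_star X P')) = CStr (Loc b P)" if "children X = children (Loc a R)" for X
      using step_Located_es(4)[OF P'(1) _ that] 3(3) by (simp add: CStr_def)
    with P' X s_Loc show ?thesis
      by - (rule exI[of _ a], rule exI[of _ R], rule exI[of _ "Loc b P'"], auto intro: step.s_Loc)
  qed
next
  case (4 P Q)
  from 4(3) have "step d (Par (encode P) (encode Q)) (Located k V) D" by simp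
  then show ?case
  proof (cases rule: step_Par_cases)
    case (ParL D')
    have "es_process P" using 4(4) by simp
    with 4(1)[OF ParL(2)] obtain a R P' where P': "step c P (Located a R) P'" "k = \<phi> (CStr (Loc a R))" "V = encode R"
      and X: "\<And>X. children X = children (Loc a R) \<Longrightarrow> subst_star (encode X) D' = encode (subst_star X P')"
      by blast
    with ParL 4(4) show ?thesis
      by - (rule exI[of _ a], rule exI[of _ R], rule exI[of _ "Par P' Q"],
        auto intro: s_ParL simp: subst_star_encode subst_star_es_P)
  next
    case (ParR D')
    have "es_process Q" using 4(4) by simp
    with 4(2)[OF ParR(2)] obtain a R Q' where Q': "step c Q (Located a R) Q'" "k = \<phi> (CStr (Loc a R))" "V = encode R"
      and X: "\<And>X. children X = children (Loc a R) \<Longrightarrow> subst_star (encode X) D' = encode (subst_star X Q')"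
      by blast
    with ParR 4(4) show ?thesis
      by - (rule exI[of _ a], rule exI[of _ R], rule exI[of _ "Par P Q'"],
        auto intro: s_ParR simp: subst_star_encode subst_star_es_P)
  qed auto
next
  case (5 M)
  then show ?case by (auto elim: step_SumE)
next
  case (6 p U)
  from 6(2) have "step d (par_list (map (\<lambda>q. Rep q (encode U)) (encode_pre p))) (Located k V) D" by simp
  from step_par_list_RepD[OF this] show ?case by (auto simp: encode_pre_In_Out)
qed (auto elim: step_HoleE step_StarE)

text \<open>Separating the owner \<open>P\<close> of the location from the updater \<open>Q\<close>
  lets one statement serve both \<open>s_UpdL\<close> and \<open>s_UpdR\<close>. The owner's
  substituted residual matches exactly, the updater's only up to
  \<open>\<equiv>\<^sub>p\<close>.\<close>

lemma encode_update:
  assumes P: "step cond_s P (Located a R) P'" "es_process P" "CStrs P \<subseteq> S"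
    and Q: "step cond_s Q (Pre (Upd a W)) Q'" "es_process Q"
    and c: "cond_s W R"
  shows "\<exists>k V D1 D2. step d (encode P) (Located k (encode R)) D1 \<and> step d (encode Q) (Pre (Upd k V)) D2 \<and>
    subst_star (fill V (encode R)) D1 = encode (subst_star (fill W R) P') \<and> D2 \<equiv>\<^sub>p encode Q'"
proof -
  have R: "es_process R" "CStr (Loc a R) \<in> S" using step_Located_es(1,2)[OF P(1,2)] P(3) by auto
  have W: "es_pre (Upd a W)" using step_Pre_es(1)[OF Q] .
  then obtain U A where UA: "W = Par (Loc a U) A" "es_P True U" "es_A False A" by auto
  obtain V where V: "Upd (\<phi> (CStr (Loc a R))) V \<in> set (encode_pre (Upd a W))"
    using encode_upd c R UA by metis
  \<comment> \<open>The decoding lemma applies in this direction too: it concerns any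
    \<open>V\<close> paired with this name.\<close>
  have fill: "fill V (encode R) = encode (fill W R)"
    using decode_upd(3)[of a R V a U A] V R UA by simp
  obtain D1 where "step d (encode P) (Located (\<phi> (CStr (Loc a R))) (encode R)) D1"
    "subst_star (encode (fill W R)) D1 = encode (subst_star (fill W R) P')"
    using encode_step_Located[OF P(1,2), of d] cond_s_fill(2)[OF c W R(1)] by blast
  moreover obtain D2 where "step d (encode Q) (Pre (Upd (\<phi> (CStr (Loc a R))) V)) D2" "D2 \<equiv>\<^sub>p encode Q'"
    using encode_step_Pre[OF Q V] by blast
  ultimately show ?thesis unfolding fill[symmetric] by blast
qed

lemma decode_update:
  assumes P: "step d (encode P) (Located k V) D1" "es_process P" "CStrs P \<subseteq> S"
    and Q: "step d (encode Q) (Pre (Upd k X)) D2" "es_process Q"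
  shows "\<exists>a R W P' Q'. step cond_s P (Located a R) P' \<and> step cond_s Q (Pre (Upd a W)) Q' \<and> cond_s W R \<and>
    subst_star (fill X V) D1 = encode (subst_star (fill W R) P') \<and> D2 \<equiv>\<^sub>p encode Q'"
proof -
  from decode_step_Located[OF P(1,2)] obtain a R P' where
    P': "step cond_s P (Located a R) P'" and kV: "k = \<phi> (CStr (Loc a R))" "V = encode R"
    and X: "\<And>X. children X = children (Loc a R) \<Longrightarrow> subst_star (encode X) D1 = encode (subst_star X P')"
    by blast
  have R: "es_process R" "CStr (Loc a R) \<in> S" using step_Located_es(1,2)[OF P' P(2)] P(3) by auto
  from decode_step_Pre[OF Q] obtain p Q' where
    Q': "step cond_s Q (Pre p) Q'" "Upd k X \<in> set (encode_pre p)" "D2 \<equiv>\<^sub>p encode Q'"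
    by blast
  have p: "es_pre p" using step_Pre_es(1)[OF Q'(1) Q(2)] .
  with Q'(2) obtain b U A where b: "p = Upd b (Par (Loc b U) A)" "es_P True U" "es_A False A"
    by (cases p) auto
  let ?W = "Par (Loc b U) A"
  have d: "a = b" "cond_s ?W R" "fill X (encode R) = encode (fill ?W R)"
    using decode_upd[of a R X b U A] Q'(2) b R kV(1) by auto
  then have "children (fill ?W R) = children (Loc a R)"
    using cond_s_fill(2)[of ?W R b] p b R by simp
  then have "subst_star (fill X V) D1 = encode (subst_star (fill ?W R) P')"
    unfolding kV d(3) by (rule X)
  then show ?thesis using P' Q' b d by blast
qed

lemma encode_step_Tau:
  assumes "step cond_s P Tau P'" and "es_process P" and "CStrs P \<subseteq> S"
  shows "\<exists>D. step cond_d (encode P) Tau D \<and> D \<equiv>\<^sub>p encode P'"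
  using assms
proof (induction P "Tau :: 'n label" P' rule: step.induct)
  case (s_Loc P P' a)
  then have "\<phi> (CStr (Loc a P')) = \<phi> (CStr (Loc a P))"
    using step_s_Tau_es[OF s_Loc(1)] by (simp add: CStr_def)
  with s_Loc show ?case by (auto intro: step.s_Loc cong_Loc)
next
  case (s_SynL P a P' Q Q')
  then show ?case
    using encode_step_Pre[OF s_SynL(1), of "In a" cond_d] encode_step_Pre[OF s_SynL(2), of "Out a" cond_d]
    by simp (meson step.s_SynL cong_Par)
next
  case (s_SynR P a P' Q Q')
  then show ?case
    using encode_step_Pre[OF s_SynR(1), of "Out a" cond_d] encode_step_Pre[OF s_SynR(2), of "In a" cond_d]
    by simp (meson step.s_SynR cong_Par)
next
  case (s_UpdL P a R P' Q W Q')
  obtain k V D1 D2 where "step cond_d (encode P) (Located k (encode R)) D1" "step cond_d (encode Q) (Pre (Upd k V)) D2"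
    "subst_star (fill V (encode R)) D1 = encode (subst_star (fill W R) P')" "D2 \<equiv>\<^sub>p encode Q'"
    using encode_update[OF s_UpdL(1) _ _ s_UpdL(2) _ s_UpdL(3)] s_UpdL(4,5) by auto blast
  moreover from this have "step cond_d (Par (encode P) (encode Q)) Tau (Par (subst_star (fill V (encode R)) D1) D2)"
    by (intro step.s_UpdL) (auto simp: cond_d_def)
  ultimately show ?case by (auto intro: cong_Par cong_refl)
next
  case (s_UpdR P a W P' Q R Q')
  obtain k V D1 D2 where "step cond_d (encode Q) (Located k (encode R)) D1" "step cond_d (encode P) (Pre (Upd k V)) D2"
    "subst_star (fill V (encode R)) D1 = encode (subst_star (fill W R) Q')" "D2 \<equiv>\<^sub>p encode P'"
    using encode_update[OF s_UpdR(2) _ _ s_UpdR(1) _ s_UpdR(3)] s_UpdR(4,5) by auto blast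
  moreover from this have "step cond_d (Par (encode P) (encode Q)) Tau (Par D2 (subst_star (fill V (encode R)) D1))"
    by (intro step.s_UpdR) (auto simp: cond_d_def)
  ultimately show ?case by (auto intro: cong_Par cong_refl)
qed (auto intro: step.s_ParL step.s_ParR cong_Par cong_refl)

lemma decode_step_Tau:
  assumes "step cond_d (encode P) Tau D" and "es_process P" and "CStrs P \<subseteq> S"
  shows "\<exists>P'. step cond_s P Tau P' \<and> D \<equiv>\<^sub>p encode P'"
  using assms
proof (induction P arbitrary: D rule: numholes.induct)
  case (3 a P)
  from 3(2) obtain D' where D: "D = Loc (\<phi> (CStr (Loc a P))) D'" and "step cond_d (encode P) Tau D'"
    by (auto elim: step_LocE)
  with 3 obtain P' where P': "step cond_s P Tau P'" "D' \<equiv>\<^sub>p encode P'" by auto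
  then have "\<phi> (CStr (Loc a P')) = \<phi> (CStr (Loc a P))"
    using step_s_Tau_es[OF P'(1)] 3(3) by (simp add: CStr_def)
  with P' D show ?case
    by (intro exI[of _ "Loc a P'"]) (auto intro: s_Loc cong_Loc)
next
  case (4 P Q)
  from 4(3) have "step cond_d (Par (encode P) (encode Q)) Tau D" by simp
  moreover have PQ: "es_process P" "es_process Q" "CStrs P \<subseteq> S" "CStrs Q \<subseteq> S" using 4(4,5) by auto
  ultimately show ?case
  proof (cases rule: step_Par_cases)
    case (ParL D')
    with 4(1) PQ obtain P' where "step cond_s P Tau P'" "D' \<equiv>\<^sub>p encode P'" by blast
    with ParL show ?thesis
      by (intro exI[of _ "Par P' Q"]) (auto intro: s_ParL cong_Par cong_refl)
  next
    case (ParR D')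
    with 4(2) PQ obtain Q' where "step cond_s Q Tau Q'" "D' \<equiv>\<^sub>p encode Q'" by blast
    with ParR show ?thesis
      by (intro exI[of _ "Par P Q'"]) (auto intro: s_ParR cong_Par cong_refl)
  next
    case (SynL a D1 D2)
    obtain P' where "step cond_s P (Pre (In a)) P'" "D1 \<equiv>\<^sub>p encode P'"
      using decode_step_Pre[OF SynL(3) PQ(1), of cond_s] by (auto simp: encode_pre_In_Out)
    moreover obtain Q' where "step cond_s Q (Pre (Out a)) Q'" "D2 \<equiv>\<^sub>p encode Q'"
      using decode_step_Pre[OF SynL(4) PQ(2), of cond_s] by (auto simp: encode_pre_In_Out)
    ultimately show ?thesis using SynL(2)
      by (intro exI[of _ "Par P' Q'"]) (auto intro: s_SynL cong_Par)
  next
    case (SynR a D1 D2)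
    obtain P' where "step cond_s P (Pre (Out a)) P'" "D1 \<equiv>\<^sub>p encode P'"
      using decode_step_Pre[OF SynR(3) PQ(1), of cond_s] by (auto simp: encode_pre_In_Out)
    moreover obtain Q' where "step cond_s Q (Pre (In a)) Q'" "D2 \<equiv>\<^sub>p encode Q'"
      using decode_step_Pre[OF SynR(4) PQ(2), of cond_s] by (auto simp: encode_pre_In_Out)
    ultimately show ?thesis using SynR(2)
      by (intro exI[of _ "Par P' Q'"]) (auto intro: s_SynR cong_Par)
  next
    case (UpdL k V D1 X D2)
    from decode_update[OF UpdL(3) PQ(1,3) UpdL(4) PQ(2)] obtain a R W P' Q' where
      "step cond_s P (Located a R) P'" "step cond_s Q (Pre (Upd a W)) Q'" "cond_s W R"
      "subst_star (fill X V) D1 = encode (subst_star (fill W R) P')" "D2 \<equiv>\<^sub>p encode Q'" by blast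
    with UpdL(2) show ?thesis
      by (intro exI[of _ "Par (subst_star (fill W R) P') Q'"]) (auto intro: s_UpdL cong_Par cong_refl)
  next
    case (UpdR k X D1 V D2)
    from decode_update[OF UpdR(4) PQ(2,4) UpdR(3) PQ(1)] obtain a R W P' Q' where
      "step cond_s Q (Located a R) P'" "step cond_s P (Pre (Upd a W)) Q'" "cond_s W R"
      "subst_star (fill X V) D2 = encode (subst_star (fill W R) P')" "D1 \<equiv>\<^sub>p encode Q'" by blast
    with UpdR(2) show ?thesis
      by (intro exI[of _ "Par Q' (subst_star (fill W R) P')"]) (auto intro: s_UpdR cong_Par cong_refl)
  qed
next
  case (5 M)
  then show ?case by (auto elim: step_SumE)
next
  case (6 p U)
  from 6(2) have "step cond_d (par_list (map (\<lambda>q. Rep q (encode U)) (encode_pre p))) Tau D" by simp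
  from step_par_list_RepD[OF this] show ?case by (auto simp: encode_pre_In_Out)
qed (auto elim: step_HoleE step_StarE)

section \<open>Injectivity of the encoding\<close>

text \<open>Holes are permitted because decoding also descends into the patterns of update
  prefixes.\<close>

definition decodable :: "'n trm \<Rightarrow> bool" where
  "decodable P \<longleftrightarrow> es_P True P \<and> no_inert S P"

definition decodable_pre :: "'n prefix \<Rightarrow> bool" where
  "decodable_pre p \<longleftrightarrow> es_pre p \<and> no_inert_pre S p"

lemma decodable_simps [simp]:
  "\<not> decodable Star"
  "decodable (Loc a P) \<longleftrightarrow> decodable P"
  "decodable (Par P Q) \<longleftrightarrow> decodable P \<and> decodable Q"
  by (auto simp: decodable_def)

lemma decodable_Sum: "decodable (Sum M) \<Longrightarrow> (p, P) \<in># M \<Longrightarrow> decodable_pre p \<and> decodable P"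
  by (auto simp: decodable_def decodable_pre_def intro: P_A)

lemma decodable_Rep: "decodable (Rep p P) \<Longrightarrow> decodable_pre p \<and> decodable P"
  by (auto simp: decodable_def decodable_pre_def intro: P_A)

lemma decodable_Upd:
  assumes "decodable_pre (Upd a W)"
  obtains U A where "W = Par (Loc a U) A" "decodable U" "decodable A" "\<not> C4 U" "C3 U \<Longrightarrow> S \<down> a \<noteq> {}"
proof -
  obtain U A where W: "W = Par (Loc a U) A" and "es_P True U" "es_A False A"
    using assms by (auto simp: decodable_pre_def)
  moreover from this have "es_P True A" by (blast intro: es_P_mono P_A)
  ultimately show thesis
    using assms by (intro that[of U A]) (auto simp: decodable_def decodable_pre_def)
qed

lemma decodable_factors: "decodable P \<Longrightarrow> X \<in> set (factors P) \<Longrightarrow> decodable X"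
  by (auto simp: decodable_def intro: factors_es_P factors_no_inert)

text \<open>\<open>no_inert_pre\<close> excludes case \<open>C3\<close> with an empty set of names,
  the only source of an empty family.\<close>

lemma encode_pre_nonempty:
  assumes "decodable_pre p"
  shows "encode_pre p \<noteq> []"
proof (cases p)
  case (Upd a W)
  with assms obtain U A where W: "W = Par (Loc a U) A" "C3 U \<Longrightarrow> S \<down> a \<noteq> {}"
    by (metis decodable_Upd)
  then have "C3 U \<Longrightarrow> enum_set (\<phi> ` (S \<down> a)) \<noteq> []"
    using set_enum_child_restr[of a] by (metis image_is_empty list.set(1))
  with Upd W show ?thesis by (auto simp: Let_def)
qed auto

text \<open>Outside \<open>C4\<close> every name used is the image of a tree whose root has a single
  child labelled \<open>a\<close>; hence \<open>a\<close> can be read off by injectivity.\<close>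

lemma encode_pre_UpdD:
  assumes "q \<in> set (encode_pre (Upd a (Par (Loc a U) A)))" "\<not> C4 U"
  obtains T where "q = Upd (\<phi> (CNode {#(a, T)#})) (Par (Loc (\<phi> (CNode {#(a, T)#})) (encode U)) (encode A))"
proof -
  have "\<kappa> a = \<phi> (CNode {#(a, CNode {#})#})"
    using phi_kappa[of Nil_proc a] by (simp add: CStr_def)
  moreover have "\<exists>T. \<phi> t = \<phi> (CNode {#(a, T)#})" if "t \<in> S \<down> a" for t
    using that by (auto simp: child_restr_def)
  moreover have "\<phi> (CStr (Loc a U)) = \<phi> (CNode {#(a, CNode (children U))#})" by (simp add: CStr_def)
  ultimately have "\<exists>T. q = Upd (\<phi> (CNode {#(a, T)#})) (Par (Loc (\<phi> (CNode {#(a, T)#})) (encode U)) (encode A))"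
    using assms C_exclusive[of U] C_exhaustive[of U] by (auto simp: Let_def split: if_splits)
  with that show thesis by blast
qed

text \<open>One member determines the prefix, so families of distinct prefixes are disjoint, as the
  cancellation argument requires. Decoding of smaller terms is a premise because the lemma is used
  inside the induction that proves it.\<close>

lemma encode_pre_inj:
  assumes IH: "\<And>U V. size U < size p \<Longrightarrow> decodable U \<Longrightarrow> decodable V \<Longrightarrow> encode U = encode V \<Longrightarrow> U = V"
    and p: "decodable_pre p" "decodable_pre p'"
    and q: "q \<in> set (encode_pre p)" "q \<in> set (encode_pre p')"
  shows "p = p'"
proof (cases p)
  case (In a)
  with q show ?thesis by (auto simp: encode_pre_In_Out)
next
  case (Out a)
  with q show ?thesis by (auto simp: encode_pre_In_Out)
next
  case (Upd a W)
  show ?thesis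
  proof (cases p')
    case (In b)
    with q show ?thesis by (auto simp: encode_pre_In_Out)
  next
    case (Out b)
    with q show ?thesis by (auto simp: encode_pre_In_Out)
  next
    case Upd': (Upd b W')
    obtain U A where W: "W = Par (Loc a U) A" "decodable U" "decodable A" "\<not> C4 U"
      using p(1) Upd by (metis decodable_Upd)
    obtain U' A' where W': "W' = Par (Loc b U') A'" "decodable U'" "decodable A'" "\<not> C4 U'"
      using p(2) Upd' by (metis decodable_Upd)
    obtain T where "q = Upd (\<phi> (CNode {#(a, T)#})) (Par (Loc (\<phi> (CNode {#(a, T)#})) (encode U)) (encode A))"
      using q(1) W unfolding Upd by (metis encode_pre_UpdD)
    moreover obtain T' where "q = Upd (\<phi> (CNode {#(b, T')#})) (Par (Loc (\<phi> (CNode {#(b, T')#})) (encode U')) (encode A'))"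
      using q(2) W' unfolding Upd' by (metis encode_pre_UpdD)
    ultimately have "encode U = encode U'" "encode A = encode A'"
      "\<phi> (CNode {#(a, T)#}) = \<phi> (CNode {#(b, T')#})" by simp_all
    then have "U = U'" "A = A'" "a = b"
      using IH[of U U'] IH[of A A'] W W' Upd by (auto simp: inj_eq[OF inj_phi])
    then show ?thesis using Upd Upd' W W' by simp
  qed
qed

text \<open>A family with several members turns a replication into a parallel composition, which
  must then be told apart from an encoded \<open>Par\<close>.\<close>

lemma encode_Rep_cases:
  assumes "decodable (Rep p U)"
  obtains q where "encode_pre p = [q]" "encode (Rep p U) = Rep q (encode U)"
  | q qs where "encode_pre p = q # qs" "qs \<noteq> []"
      "encode (Rep p U) = Par (Rep q (encode U)) (par_list (map (\<lambda>q. Rep q (encode U)) qs))"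
proof (cases "encode_pre p")
  case Nil
  with assms show ?thesis using encode_pre_nonempty decodable_Rep by blast
next
  case (Cons q qs)
  with that show ?thesis by (cases "qs = []") (auto simp: par_list_Cons)
qed

lemma encode_eq_Rep:
  assumes "encode P = Rep q V" "decodable P"
  obtains p U where "P = Rep p U" "encode_pre p = [q]" "encode U = V"
proof (cases P)
  case (Rep p U)
  with assms(2) have "decodable (Rep p U)" by simp
  then show ?thesis using assms(1) Rep that by (cases rule: encode_Rep_cases) auto
qed (use assms in auto)

text \<open>
  Structural congruence does not reach into prefixes, so update patterns have to be recovered from
  their encodings exactly.
\<close>

lemma encode_inj: "decodable P \<Longrightarrow> decodable Q \<Longrightarrow> encode P = encode Q \<Longrightarrow> P = Q"
proof (induction P arbitrary: Q rule: measure_induct_rule[of size])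
  case (less P)
  have pre: "p = p'"
    if "size p < size P" "decodable_pre p" "decodable_pre p'"
      "q \<in> set (encode_pre p)" "q \<in> set (encode_pre p')" for p p' q
    by (rule encode_pre_inj[OF less.IH[OF less_trans[OF _ that(1)]] that(2-5)])
  show ?case
  proof (cases P)
    case Hole
    with less.prems show ?thesis
      by (cases Q) (auto elim: encode_Rep_cases)
  next
    case Star
    with less.prems show ?thesis by simp
  next
    case (Loc a P1)
    show ?thesis
    proof (cases Q)
      case (Loc b Q1)
      with \<open>P = Loc a P1\<close> less show ?thesis by (auto simp: phi_Loc_eq_iff)
    qed (use Loc less.prems in \<open>auto elim: encode_Rep_cases\<close>)
  next
    case (Par P1 P2)
    show ?thesis
    proof (cases Q)
      case Q: (Par Q1 Q2)
      with Par less show ?thesis by auto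
    next
      case (Rep p U)
      with less.prems have d: "decodable (Rep p U)" by simp
      then show ?thesis
      proof (cases rule: encode_Rep_cases)
        case (2 q qs)
        \<comment> \<open>The left component is a lone replication, so its prefix has the one-member
          family \<open>[q]\<close>. Sharing \<open>q\<close> with \<open>p\<close> makes the
          prefixes equal, although the family of \<open>p\<close> has further members.\<close>
        then have "encode P1 = Rep q (encode U)" using less.prems Par Rep by simp
        then obtain p1 U1 where P1: "P1 = Rep p1 U1" "encode_pre p1 = [q]"
          using less.prems(1) Par by (auto elim: encode_eq_Rep)
        have "p1 = p" using P1 Par 2 d less.prems(1) by (intro pre[of p1 p q]) (auto dest: decodable_Rep)
        with P1 2 show ?thesis by simp
      qed (use less.prems Par Rep in auto)
    qed (use Par less.prems in auto)
  next
    case (Sum M)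
    show ?thesis
    proof (cases Q)
      case Q: (Sum N)
      let ?f = "\<lambda>(p, U). mset (map (\<lambda>q. (q, encode U)) (encode_pre p))"
      \<comment> \<open>Summands whose families share a member coincide, so the flattened sum splits
        into families in only one way.\<close>
      have "image_mset id M = image_mset id N"
      proof (rule sum_mset_image_eq_cancel[where f = ?f])
        show "?f x \<noteq> {#}" if "x \<in># M + N" for x
          using that less.prems Sum Q by (cases x) (auto simp: encode_pre_nonempty dest: decodable_Sum)
        show "id x = id y \<and> ?f x = ?f y"
          if x: "x \<in># M" and y: "y \<in># N" and b: "b \<in># ?f x" "b \<in># ?f y" for x y b
        proof -
          obtain p U p' V where xy: "x = (p, U)" "y = (p', V)" by (cases x, cases y)
          have s: "size p < size P" "size U < size P"
            using size_Sum[of p U M] x xy Sum by simp_all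
          have d: "decodable_pre p" "decodable U" "decodable_pre p'" "decodable V"
            using x y xy less.prems Sum Q by (auto dest: decodable_Sum)
          from b xy obtain q where "q \<in> set (encode_pre p)" "q \<in> set (encode_pre p')" "encode U = encode V"
            by auto
          then have "p = p'" "U = V" using s d pre less.IH by blast+
          with xy show ?thesis by simp
        qed
        show "(\<Sum>x\<in>#M. ?f x) = (\<Sum>x\<in>#N. ?f x)" using less.prems Sum Q by simp
      qed
      with Sum Q show ?thesis by simp
    qed (use Sum less.prems in \<open>auto elim: encode_Rep_cases\<close>)
  next
    case (Rep p U)
    with less.prems have d: "decodable (Rep p U)" by simp
    show ?thesis
    proof (cases Q)
      case Q: (Rep p' U')
      with less.prems have d': "decodable (Rep p' U')" by simp
      have e: "encode (Rep p U) = encode (Rep p' U')" using less.prems(3) Rep Q by simp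
      \<comment> \<open>A single member and several members give different top constructors; in the
        remaining cases the first members agree.\<close>
      have "\<exists>q. q \<in> set (encode_pre p) \<and> q \<in> set (encode_pre p') \<and> encode U = encode U'"
        by (rule encode_Rep_cases[OF d]; rule encode_Rep_cases[OF d'])
          (use e in \<open>auto simp del: enc.simps\<close>)
      then obtain q where q: "q \<in> set (encode_pre p)" "q \<in> set (encode_pre p')" and U: "encode U = encode U'"
        by blast
      have "p = p'" "U = U'"
        using d d' U Rep by (auto intro!: pre[OF _ _ _ q] less.IH dest: decodable_Rep)
      with Rep Q show ?thesis by simp
    next
      case (Par Q1 Q2)
      from d show ?thesis
      proof (cases rule: encode_Rep_cases)
        case (2 q qs)
        then have "encode Q1 = Rep q (encode U)" using less.prems Par Rep by simp
        then obtain p1 U1 where Q1: "Q1 = Rep p1 U1" "encode_pre p1 = [q]"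
          using less.prems(2) Par by (auto elim: encode_eq_Rep)
        have "p = p1" using Q1 Par 2 d Rep less.prems(2) by (intro pre[of p p1 q]) (auto dest: decodable_Rep)
        with Q1 2 show ?thesis by simp
      qed (use less.prems Par Rep in auto)
    qed (rule encode_Rep_cases[OF d]; use Rep less.prems in \<open>simp del: enc.simps(6)\<close>)+
  qed
qed

section \<open>Decoding up to structural congruence\<close>

lemma components_encode_factors:
  "components (encode P) = (\<Sum>X\<in>#mset (factors P). components (encode X))"
  by (induction P rule: factors.induct) auto

lemma components_encode_Sum:
  "components (encode (Sum M)) =
    {#SumC (\<Sum>(p, U)\<in>#M. mset (map (\<lambda>q. (q, components (encode U))) (encode_pre p)))#}"
  by (simp add: image_mset_sum_mset multiset.map_comp comp_def case_prod_unfold)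

lemma components_encode_Rep:
  assumes "decodable (Rep p U)"
  shows "components (encode (Rep p U)) = mset (map (\<lambda>q. RepC q (components (encode U))) (encode_pre p))"
  using encode_pre_nonempty decodable_Rep[OF assms]
  by (simp add: components_par_list multiset.map_comp comp_def)

text \<open>Each factor of \<open>P\<close> yields a family of components, and cancellation applies
  once families sharing a component are shown equal. Prefixes are recovered exactly through
  \<open>encode_inj\<close>, bodies only up to their components.\<close>

lemma components_encode_inj:
  "decodable P \<Longrightarrow> decodable Q \<Longrightarrow> components (encode P) = components (encode Q) \<Longrightarrow>
    components P = components Q"
proof (induction P arbitrary: Q rule: measure_induct_rule[of size])
  case (less P)
  have pre: "p = p'"
    if "decodable_pre p" "decodable_pre p'"
      "q \<in> set (encode_pre p)" "q \<in> set (encode_pre p')" for p p' q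
    by (rule encode_pre_inj[OF encode_inj that])
  have "image_mset components (mset (factors P)) = image_mset components (mset (factors Q))"
  proof (rule sum_mset_image_eq_cancel[where f = "\<lambda>X. components (encode X)"])
    show "(\<Sum>X\<in>#mset (factors P). components (encode X)) = (\<Sum>X\<in>#mset (factors Q). components (encode X))"
      using less.prems(3) by (simp flip: components_encode_factors)
    show "components (encode X) \<noteq> {#}" for X by (rule components_nonempty)
    show "components X = components Y \<and> components (encode X) = components (encode Y)"
      if X: "X \<in># mset (factors P)" and Y: "Y \<in># mset (factors Q)"
        and b: "b \<in># components (encode X)" "b \<in># components (encode Y)" for X Y b
    proof -
      have dX: "decodable X" and dY: "decodable Y"
        using X Y less.prems decodable_factors by auto
      have IH: "components U = components V"
        if "size U < size X" "decodable U" "decodable V" "components (encode U) = components (encode V)" for U V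
      proof -
        have "X \<in> set (factors P)" using X by simp
        then have "size U < size P" using that(1) size_factors by fastforce
        from less.IH[OF this that(2-4)] show ?thesis .
      qed
      have par: "X \<noteq> Par U V" "Y \<noteq> Par U V" for U V
        using X Y by (auto dest: factors_not_Par)
      show ?thesis
      proof (cases X)
        case Hole
        with b par dY show ?thesis
          by (cases Y) (auto simp: components_encode_Rep simp del: enc.simps(6))
      next
        case Star
        with dX show ?thesis by simp
      next
        case (Loc a U)
        with b par dY obtain V where V: "Y = Loc a V" "components (encode U) = components (encode V)"
            "children U = children V"
          by (cases Y) (auto simp: components_encode_Rep phi_Loc_eq_iff simp del: enc.simps(6))
        have "components U = components V"
          by (rule IH) (use Loc V dX dY in simp_all)
        with Loc V show ?thesis by (simp add: CStr_def)
      next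
        case (Par U V)
        with par(1) show ?thesis by blast
      next
        case (Sum M)
        let ?f = "\<lambda>(p, U). mset (map (\<lambda>q. (q, components (encode U))) (encode_pre p))"
        let ?g = "\<lambda>(p, U). (p, components U)"
        obtain N where Ysum: "Y = Sum N"
          using Sum b par dY by (cases Y) (auto simp: components_encode_Rep simp del: enc.simps(6))
        \<comment> \<open>An encoded sum is a single component, so sharing \<open>b\<close>
          identifies the two sums completely.\<close>
        have f_eq: "(\<Sum>x\<in>#M. ?f x) = (\<Sum>x\<in>#N. ?f x)"
          using b unfolding Sum Ysum components_encode_Sum by simp
        have "image_mset ?g M = image_mset ?g N"
        proof (rule sum_mset_image_eq_cancel[where f = ?f, OF _ _ f_eq])
          show "?f x \<noteq> {#}" if "x \<in># M + N" for x
            using that dX dY Sum Ysum by (cases x) (auto simp: encode_pre_nonempty dest: decodable_Sum)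
          show "?g x = ?g y \<and> ?f x = ?f y"
            if x: "x \<in># M" and y: "y \<in># N" and c: "c \<in># ?f x" "c \<in># ?f y" for x y c
          proof -
            obtain p U p' V where xy: "x = (p, U)" "y = (p', V)" by (cases x, cases y)
            have s: "size U < size X"
              using size_Sum[of p U M] x xy Sum by simp_all
            have d: "decodable_pre p" "decodable U" "decodable_pre p'" "decodable V"
              using x y xy dX dY Sum Ysum by (auto dest: decodable_Sum)
            from c xy obtain q where "q \<in> set (encode_pre p)" "q \<in> set (encode_pre p')"
              and e: "components (encode U) = components (encode V)"
              by auto
            then have "p = p'" "components U = components V" using s d pre IH by blast+
            with xy e show ?thesis by simp
          qed
        qed
        with f_eq show ?thesis unfolding Sum Ysum components_encode_Sum by simp
      next
        case (Rep p U)
        with dX have d: "decodable (Rep p U)" by simp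
        obtain p' V where Yrep: "Y = Rep p' V"
          using Rep b par dY
          by (cases Y) (auto simp: components_encode_Rep[OF d] simp del: enc.simps(6))
        with dY have d': "decodable (Rep p' V)" by simp
        obtain q where "q \<in> set (encode_pre p)" "q \<in> set (encode_pre p')"
          and e: "components (encode U) = components (encode V)"
          using b unfolding Rep Yrep components_encode_Rep[OF d] components_encode_Rep[OF d'] by auto
        then have "p = p'" "components U = components V"
          using pre IH[of U V] d d' Rep by (auto dest: decodable_Rep)
        with e show ?thesis
          unfolding Rep Yrep components_encode_Rep[OF d] components_encode_Rep[OF d'] by simp
      qed
    qed
  qed
  then show ?case by (metis components_factors)
qed

lemma encode_scong_iff:
  assumes "es_process P" "no_inert S P" "es_process Q" "no_inert S Q"
  shows "encode P \<equiv>\<^sub>p encode Q \<longleftrightarrow> P \<equiv>\<^sub>p Q"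
  using assms components_encode_inj[of P Q]
  by (auto simp: decodable_def es_P_mono intro: encode_scong components_eq_imp_scong
      dest: scong_imp_components_eq)

section \<open>Reductions and the main result\<close>

lemma encode_red:
  assumes "es_process P" "CStrs P \<subseteq> S" "P \<rightarrow>\<^sub>s P'"
  shows "encode P \<rightarrow>\<^sub>d encode P'"
proof -
  obtain Q where Q: "step cond_s P Tau Q" "Q \<equiv>\<^sub>p P'" using assms(3) by (auto simp: red_s_def)
  then obtain D where "step cond_d (encode P) Tau D" "D \<equiv>\<^sub>p encode Q"
    using encode_step_Tau assms(1,2) by blast
  with encode_scong[OF Q(2)] show ?thesis by (auto simp: red_d_def intro: cong_trans)
qed

lemma decode_red:
  assumes "es_process P" "CStrs P \<subseteq> S" "encode P \<rightarrow>\<^sub>d D"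
  obtains Q where "step cond_s P Tau Q" "encode Q \<equiv>\<^sub>p D"
  using assms decode_step_Tau[of P] unfolding red_d_def by (meson cong_sym cong_trans)

end

theorem theorem2p26:
  fixes S :: "'n::{countable,infinite} cstr set"
    and \<phi> :: "'n cstr \<Rightarrow> 'n"
    and \<kappa> :: "'n \<Rightarrow> 'n"
    and err :: 'n
    and P P' :: "'n trm"
  assumes "inj \<phi>"
    and "\<And>a Q. numap Q = 0 \<Longrightarrow> \<phi> (CStr (Loc a Q)) = \<kappa> a"
    and "err \<notin> \<phi> ` S"
    and "\<And>a. finite (S \<down> a)"
    and "es_process P"
    and "CStrs P \<subseteq> S"
    and "es_process P'"
  shows "(P \<rightarrow>\<^sub>s P' \<longrightarrow> enc S \<phi> \<kappa> err P \<rightarrow>\<^sub>d enc S \<phi> \<kappa> err P') \<and>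
         (enc S \<phi> \<kappa> err P \<rightarrow>\<^sub>d enc S \<phi> \<kappa> err P' \<longrightarrow>
           (\<exists>P''. es_process P'' \<and> P \<rightarrow>\<^sub>s P'' \<and> enc S \<phi> \<kappa> err P'' \<equiv>\<^sub>p enc S \<phi> \<kappa> err P')) \<and>
         (no_inert S P \<and> no_inert S P' \<longrightarrow>
           (P \<rightarrow>\<^sub>s P' \<longleftrightarrow> enc S \<phi> \<kappa> err P \<rightarrow>\<^sub>d enc S \<phi> \<kappa> err P'))"
proof -
  interpret encoding S \<phi> \<kappa> err
    using assms(1-4) by unfold_locales
  \<comment> \<open>The decoded residual inherits \<open>no_inert\<close> from \<open>P\<close>, so
    its congruence with \<open>P'\<close> can be read off from the encodings.\<close>
  have decode: "\<exists>Q. step cond_s P Tau Q \<and> es_process Q \<and> (no_inert S P \<longrightarrow> no_inert S Q) \<and> encode Q \<equiv>\<^sub>p encode P'"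
    if "encode P \<rightarrow>\<^sub>d encode P'"
    using decode_red[OF assms(5,6) that] step_s_Tau_es[OF _ assms(5), of _ S] by metis
  show ?thesis
  proof (intro conjI impI)
    assume "encode P \<rightarrow>\<^sub>d encode P'"
    with decode show "\<exists>P''. es_process P'' \<and> P \<rightarrow>\<^sub>s P'' \<and> encode P'' \<equiv>\<^sub>p encode P'"
      unfolding red_s_def by (meson cong_refl)
  next
    assume "no_inert S P \<and> no_inert S P'"
    then show "P \<rightarrow>\<^sub>s P' \<longleftrightarrow> encode P \<rightarrow>\<^sub>d encode P'"
      using decode encode_scong_iff assms(5-7) encode_red unfolding red_s_def by metis
  qed (rule encode_red[OF assms(5,6)])
qed

end
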